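(* Let $p$ be an odd prime, $m\geq1$ an integer, $q=p^m$, and let $\zeta$ be a primitive element of the field $K=GF(q^2)$. Then the group $(PGL_2(q^2))_{\bar\varphi}\cong \mathrm{M}(q^2)$ is generated by symbols $a,T,J$, subject to the defining relations \begin{align*} &[J,a]^{\frac{q^2-1}{2}}=1,\quad a^2=[J,a]^{-\frac{q+1}{2}},\quad a^{[J,a]}=[J,a]^{q-1}a,\\ &T^2=1,\\ &T\,R(\zeta^j)\,T=R(\zeta^{k_j})\,T\,R\big(\zeta^{\frac{q^2-1}{2}-k_j+j}\big)&&(1\leq j<q^2-1,\ 2\mid k_j),\\ &T\,R(\zeta^j)\,T=R(\zeta^{k_j})\,T\,R\big(\zeta^{\frac{q^2-1}{2}-qk_j+qj}\big)&&(1\leq j<q^2-1,\ 2\nmid k_j),\\ &J^2=(J[J,a])^2=(JT)^3=1, \end{align*} where $k_j$ is the integer in the range $1\leq k_j<q^2-1$ satisfying $1-\zeta^j=\zeta^{k_j}$, and $R(\zeta^k)$ has to be rewritten as the word $$R(\zeta^k)=[J,a]^{\lceil k/2\rceil}\,a^{\,k-2\lfloor k/2\rfloor},\qquad 1\leq k<q^2-1$$ (exponents of $\zeta$ being read modulo $q^2-1$).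
   Context: Conventions: $[x,y]=xyx^{-1}y^{-1}$ and $x^y=y^{-1}xy$. "Generated by symbols subject to relations" means that the abstract group with this presentation is isomorphic to the given group. $\mathrm{M}(q^2)$ is the (sharply 3-transitive) group of permutations $h$ of the projective line $\mathbb{P}^1(K)=K\cup\{\infty\}$ of the form $h(\omega)=\frac{a\beta(\omega)+b}{c\beta(\omega)+d}$ with $a,b,c,d\in K$, $\Delta=ad-bc\neq0$, where $\beta$ is the identity if $\Delta\in(K^\times)^2$ and $\beta=\alpha$ if $\Delta\notin(K^\times)^2$; here $\alpha(\omega)=\omega^q$ for $\omega\in K$, $\alpha(\infty)=\infty$. $(PGL_2(q^2))_{\bar\varphi}$ is the set $PGL_2(K)$ with the group operation $g_1\circ g_2=g_1\cdot\bar\varphi(g_1)^{-1}(g_2)$, where $\bar\varphi:PGL_2(K)\to\mathrm{Aut}(PGL_2(K))$ sends the class of a matrix $A$ to the identity if $\det A\in(K^\times)^2$, and otherwise to the automorphism $\bar\alpha$ of $PGL_2(K)$ induced by applying $\alpha$ to matrix entries. The map sending the Möbius transformation $\omega\mapsto\frac{a\omega+b}{c\omega+d}$ to $\omega\mapsto\frac{a\beta(\omega)+b}{c\beta(\omega)+d}$ (where $\beta$ is the identity if $ad-bc\in(K^\times)^2$ and $\beta=\alpha$ if $ad-bc\notin(K^\times)^2$) is an isomorphism $(PGL_2(q^2))_{\bar\varphi}\to\mathrm{M}(q^2)$. In $\mathrm{M}(q^2)$ the generators correspond to $a:\omega\mapsto\zeta^{-1}\omega^q$, $T:\omega\mapsto1-\omega$,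 $J:\omega\mapsto\omega^{-1}$ (so that $[J,a]$ is $\omega\mapsto\zeta^2\omega$). *)

theory Defs
  imports
    "HOL-Analysis.Determinants"
    "HOL-Algebra.Coset"
    "HOL-Algebra.Bij"
    "HOL-Computational_Algebra.Primes"
begin

section \<open>Groups given by generators and relations\<close>

text \<open>
  A letter is a pair of a generator and a sign, \<^term>\<open>(x, True)\<close> standing for \<open>x\<close> and
  \<^term>\<open>(x, False)\<close> for its formal inverse. The elements of the free group on the type
  \<^typ>\<open>'a\<close> are the classes of words modulo insertion and deletion of cancelling pairs.
\<close>

inductive cancels :: "('a \<times> bool) list \<Rightarrow> ('a \<times> bool) list \<Rightarrow> bool" where
  "cancels (u @ [(x, s), (x, \<not> s)] @ v) (u @ v)"

definition free_equiv :: "(('a \<times> bool) list \<times> ('a \<times> bool) list) set" where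
  "free_equiv = {(u, v). equivclp cancels u v}"

definition free_group :: "('a \<times> bool) list set monoid" where
  "free_group =
    \<lparr>carrier = UNIV // free_equiv,
     mult = (\<lambda>X Y. \<Union>u\<in>X. \<Union>v\<in>Y. free_equiv `` {u @ v}),
     one = free_equiv `` {[]}\<rparr>"

definition free_gen :: "'a \<Rightarrow> ('a \<times> bool) list set" where
  "free_gen x = free_equiv `` {[(x, True)]}"

definition normal_closure :: "('g, 'b) monoid_scheme \<Rightarrow> 'g set \<Rightarrow> 'g set" where
  "normal_closure G R = \<Inter>{N. N \<lhd> G \<and> R \<subseteq> N}"

text \<open>A relation \<open>l = r\<close> between words is given as a pair \<^term>\<open>(l, r)\<close> of elements of the
  free group.\<close>

definition relators ::
  "(('a \<times> bool) list set \<times> ('a \<times> bool) list set) set \<Rightarrow> ('a \<times> bool) list set set" where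
  "relators rels = {l \<otimes>\<^bsub>free_group\<^esub> inv\<^bsub>free_group\<^esub> r | l r. (l, r) \<in> rels}"

definition presented_group ::
  "(('a \<times> bool) list set \<times> ('a \<times> bool) list set) set \<Rightarrow> ('a \<times> bool) list set set monoid" where
  "presented_group rels = free_group Mod (normal_closure free_group (relators rels))"

definition presented_gen ::
  "(('a \<times> bool) list set \<times> ('a \<times> bool) list set) set \<Rightarrow> 'a \<Rightarrow> ('a \<times> bool) list set set" where
  "presented_gen rels x =
     normal_closure free_group (relators rels) #>\<^bsub>free_group\<^esub> free_gen x"

definition commutator :: "('g, 'b) monoid_scheme \<Rightarrow> 'g \<Rightarrow> 'g \<Rightarrow> 'g" where
  "commutator G x y = x \<otimes>\<^bsub>G\<^esub> y \<otimes>\<^bsub>G\<^esub> inv\<^bsub>G\<^esub> x \<otimes>\<^bsub>G\<^esub> inv\<^bsub>G\<^esub> y"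

definition conjugate :: "('g, 'b) monoid_scheme \<Rightarrow> 'g \<Rightarrow> 'g \<Rightarrow> 'g" where
  "conjugate G x y = inv\<^bsub>G\<^esub> y \<otimes>\<^bsub>G\<^esub> x \<otimes>\<^bsub>G\<^esub> y"


section \<open>The groups \<open>PGL\<^sub>2\<close>, its twisted form, and \<open>M(q\<^sup>2)\<close>\<close>

text \<open>The field \<open>K = GF(q\<^sup>2)\<close> is a finite field type \<^typ>\<open>'k\<close>; that it has \<open>q\<^sup>2\<close> elements is a
  hypothesis of the theorem.\<close>

definition primitive_element :: "'k::field \<Rightarrow> bool" where
  "primitive_element \<zeta> \<longleftrightarrow> {\<zeta> ^ n | n::nat. True} = {x. x \<noteq> 0}"

definition unit_square :: "'k::field \<Rightarrow> bool" where
  "unit_square x \<longleftrightarrow> (\<exists>y. y \<noteq> 0 \<and> x = y ^ 2)"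

definition frob :: "nat \<Rightarrow> 'k::field \<Rightarrow> 'k" where
  "frob q \<omega> = \<omega> ^ q"

definition GL2 :: "('k::field ^ 2 ^ 2) monoid" where
  "GL2 = \<lparr>carrier = {A. det A \<noteq> 0}, mult = (**), one = mat 1\<rparr>"

definition scalars2 :: "('k::field ^ 2 ^ 2) set" where
  "scalars2 = {mat c | c. c \<noteq> 0}"

definition PGL2 :: "('k::field ^ 2 ^ 2) set monoid" where
  "PGL2 = GL2 Mod scalars2"

text \<open>Elements of \<^const>\<open>PGL2\<close> are cosets of the scalar matrices, so the square class of the
  determinant is the same for all members of a coset.\<close>

definition phi_bar :: "nat \<Rightarrow> ('k::field ^ 2 ^ 2) set \<Rightarrow> ('k ^ 2 ^ 2) set \<Rightarrow> ('k ^ 2 ^ 2) set" where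
  "phi_bar q X =
     (if \<exists>A\<in>X. unit_square (det A) then (\<lambda>Y. Y) else (\<lambda>Y. map_matrix (frob q) ` Y))"

definition PGL2_twisted :: "nat \<Rightarrow> ('k::field ^ 2 ^ 2) set monoid" where
  "PGL2_twisted q =
    \<lparr>carrier = carrier PGL2,
     mult = (\<lambda>g1 g2. g1 \<otimes>\<^bsub>PGL2\<^esub> inv_into (carrier PGL2) (phi_bar q g1) g2),
     one = \<one>\<^bsub>PGL2\<^esub>\<rparr>"

text \<open>The projective line \<open>P\<^sup>1(K)\<close> is \<^typ>\<open>'k option\<close>, with \<^const>\<open>None\<close> as the point at infinity.\<close>

definition moebius :: "'k::field ^ 2 ^ 2 \<Rightarrow> 'k option \<Rightarrow> 'k option" where
  "moebius A \<omega> =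
    (case \<omega> of
       None \<Rightarrow> if A$2$1 = 0 then None else Some (A$1$1 / A$2$1)
     | Some z \<Rightarrow> if A$2$1 * z + A$2$2 = 0 then None
                 else Some ((A$1$1 * z + A$1$2) / (A$2$1 * z + A$2$2)))"

definition twisted_moebius :: "nat \<Rightarrow> 'k::field ^ 2 ^ 2 \<Rightarrow> 'k option \<Rightarrow> 'k option" where
  "twisted_moebius q A =
    moebius A \<circ> (if unit_square (det A) then (\<lambda>\<omega>. \<omega>) else map_option (frob q))"

text \<open>The product \<open>g \<otimes> f\<close> in \<^const>\<open>BijGroup\<close> applies \<open>f\<close> first.\<close>

definition M_group :: "nat \<Rightarrow> ('k::field option \<Rightarrow> 'k option) monoid" where
  "M_group q =
     (BijGroup UNIV)\<lparr>carrier := {h \<in> Bij UNIV. \<exists>A. det A \<noteq> 0 \<and> h = twisted_moebius q A}\<rparr>"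

definition perm_a :: "nat \<Rightarrow> 'k::field \<Rightarrow> 'k option \<Rightarrow> 'k option" where
  "perm_a q \<zeta> = map_option (\<lambda>\<omega>. inverse \<zeta> * \<omega> ^ q)"

definition perm_T :: "'k::field option \<Rightarrow> 'k option" where
  "perm_T = map_option (\<lambda>\<omega>. 1 - \<omega>)"

definition perm_J :: "'k::field option \<Rightarrow> 'k option" where
  "perm_J \<omega> = (case \<omega> of None \<Rightarrow> Some 0 | Some z \<Rightarrow> if z = 0 then None else Some (inverse z))"


section \<open>The presentation\<close>

datatype gen = Gen_a | Gen_T | Gen_J

abbreviation FG :: "(gen \<times> bool) list set monoid" where "FG \<equiv> free_group"

abbreviation sym_a :: "(gen \<times> bool) list set" where "sym_a \<equiv> free_gen Gen_a"
abbreviation sym_T :: "(gen \<times> bool) list set" where "sym_T \<equiv> free_gen Gen_T"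
abbreviation sym_J :: "(gen \<times> bool) list set" where "sym_J \<equiv> free_gen Gen_J"

abbreviation sym_D :: "(gen \<times> bool) list set" where "sym_D \<equiv> commutator FG sym_J sym_a"

text \<open>\<open>R_word q k\<close> is the word for \<open>R(\<zeta>\<^sup>k)\<close>. The exponent \<open>k\<close> is first reduced modulo
  \<open>q\<^sup>2 - 1\<close>; it is never divisible by \<open>q\<^sup>2 - 1\<close> where it occurs in the relations.\<close>

definition R_word :: "nat \<Rightarrow> int \<Rightarrow> (gen \<times> bool) list set" where
  "R_word q k =
    (let r = k mod ((int q)\<^sup>2 - 1)
     in sym_D [^]\<^bsub>FG\<^esub> \<lceil>real_of_int r / 2\<rceil> \<otimes>\<^bsub>FG\<^esub> sym_a [^]\<^bsub>FG\<^esub> (r - 2 * \<lfloor>real_of_int r / 2\<rfloor>))"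

text \<open>\<open>is_k q \<zeta> j k\<close> says that \<open>k\<close> is the integer \<open>k\<^sub>j\<close>.\<close>

definition is_k :: "nat \<Rightarrow> 'k::field \<Rightarrow> nat \<Rightarrow> nat \<Rightarrow> bool" where
  "is_k q \<zeta> j k \<longleftrightarrow> 1 \<le> k \<and> k < q\<^sup>2 - 1 \<and> 1 - \<zeta> ^ j = \<zeta> ^ k"

definition M_relations ::
  "nat \<Rightarrow> 'k::field \<Rightarrow> ((gen \<times> bool) list set \<times> (gen \<times> bool) list set) set" where
  "M_relations q \<zeta> =
    {(sym_D [^]\<^bsub>FG\<^esub> (((int q)\<^sup>2 - 1) div 2), \<one>\<^bsub>FG\<^esub>),
     (sym_a [^]\<^bsub>FG\<^esub> (2::int), sym_D [^]\<^bsub>FG\<^esub> (- ((int q + 1) div 2))),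
     (conjugate FG sym_a sym_D, sym_D [^]\<^bsub>FG\<^esub> (int q - 1) \<otimes>\<^bsub>FG\<^esub> sym_a),
     (sym_T [^]\<^bsub>FG\<^esub> (2::int), \<one>\<^bsub>FG\<^esub>)}
    \<union> {(sym_T \<otimes>\<^bsub>FG\<^esub> R_word q (int j) \<otimes>\<^bsub>FG\<^esub> sym_T,
        R_word q (int k) \<otimes>\<^bsub>FG\<^esub> sym_T \<otimes>\<^bsub>FG\<^esub>
          R_word q (((int q)\<^sup>2 - 1) div 2 - int k + int j)) | j k.
        1 \<le> j \<and> j < q\<^sup>2 - 1 \<and> is_k q \<zeta> j k \<and> even k}
    \<union> {(sym_T \<otimes>\<^bsub>FG\<^esub> R_word q (int j) \<otimes>\<^bsub>FG\<^esub> sym_T,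
        R_word q (int k) \<otimes>\<^bsub>FG\<^esub> sym_T \<otimes>\<^bsub>FG\<^esub>
          R_word q (((int q)\<^sup>2 - 1) div 2 - int q * int k + int q * int j)) | j k.
        1 \<le> j \<and> j < q\<^sup>2 - 1 \<and> is_k q \<zeta> j k \<and> odd k}
    \<union> {(sym_J [^]\<^bsub>FG\<^esub> (2::int), \<one>\<^bsub>FG\<^esub>),
       ((sym_J \<otimes>\<^bsub>FG\<^esub> sym_D) [^]\<^bsub>FG\<^esub> (2::int), \<one>\<^bsub>FG\<^esub>),
       ((sym_J \<otimes>\<^bsub>FG\<^esub> sym_T) [^]\<^bsub>FG\<^esub> (3::int), \<one>\<^bsub>FG\<^esub>)}"

end

theory Submission
  imports Defs "HOL-Number_Theory.Residues"
begin

text \<open>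
  In a group satisfying the relations, the elements \<open>R(\<zeta>\<^sup>k)\<close> form a subgroup \<open>N\<close>, a copy of the
  multiplicative group of the nearfield on \<open>K\<close> with product \<open>x \<bullet> y = x \<beta>\<^sub>x(y)\<close>. The relations
  involving \<open>T\<close> make \<open>B = N \<union> NTN\<close> a subgroup, and since \<open>JNJ = N\<close> and \<open>JTJ = TJT\<close>, the set
  \<open>B \<union> BJB\<close> is closed under left multiplication by the generators, so it is the whole group.
  In \<open>M(q\<^sup>2)\<close> the elements of \<open>B\<close> fix \<open>\<infinity>\<close> and those of \<open>BJB\<close> move it; the elements of \<open>NTN\<close> move \<open>0\<close>;
  and \<open>R(\<zeta>\<^sup>k)\<close> sends \<open>1\<close> to \<open>\<zeta>\<^sup>k\<close>. Hence the natural map onto \<open>M(q\<^sup>2)\<close> has trivial kernel. It is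
  onto because a subgroup containing \<open>N\<close>, \<open>T\<close> and \<open>J\<close> is triply transitive, while only the identity
  of \<open>M(q\<^sup>2)\<close> fixes \<open>0\<close>, \<open>1\<close> and \<open>\<infinity>\<close>.
\<close>

section \<open>Free groups and presentations\<close>

text \<open>No element count and no normal form in the presented group is used: closure of one
  subset under left multiplication suffices, because the kernel is tested by the action on
  \<infinity>, 0 and 1. The relations for T come from one identity. Write k for the exponent with 1
  - \<zeta>^j = \<zeta>^k, and z' for z or z^q according to the parity of j. Then 1 - \<zeta>^j (1 -
  z') = \<zeta>^k (1 + \<zeta>^(j-k) z'). The plus sign costs a factor -1, which is \<zeta> to the
  power (q^2 - 1)/2. If k is odd, Frobenius still acts on the inner factor, so its exponent is
  multiplied by q in advance, and x^(q^2) = x restores it. Exponents modulo q^2 - 1 carry the whole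
  computation. Evenness of q^2 - 1 makes their parity meaningful; divisibility by 4 makes (q^2 -
  1)/2 even, so that -1 is a square and the sign does not disturb parities. The twisted group enters
  only through its isomorphism with M(q^2); the relations are verified on permutations.\<close>

lemma equiv_free_equiv: "equiv UNIV free_equiv"
  unfolding free_equiv_def
  by (auto intro!: equivI simp: refl_on_def sym_def trans_def
      intro: equivclp_sym equivclp_trans)

lemma cancels_context:
  assumes "cancels u v" shows "cancels (x @ u @ y) (x @ v @ y)"
  using assms
proof cases
  case (1 u' a s v')
  show ?thesis unfolding 1 using cancels.intros[of "x @ u'" a s "v' @ y"] by simp
qed

lemma free_equiv_context:
  assumes "(u, v) \<in> free_equiv" shows "(x @ u @ y, x @ v @ y) \<in> free_equiv"
proof -
  have "equivclp cancels u v" using assms by (simp add: free_equiv_def)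
  then have "equivclp cancels (x @ u @ y) (x @ v @ y)"
  proof (induction rule: equivclp_induct)
    case (step v w)
    then show ?case
      by (meson cancels_context equivclp_into_equivclp)
  qed simp
  then show ?thesis by (simp add: free_equiv_def)
qed

lemma free_equiv_append:
  assumes "(u, u') \<in> free_equiv" "(v, v') \<in> free_equiv"
  shows "(u @ v, u' @ v') \<in> free_equiv"
proof -
  have "(u @ v, u' @ v) \<in> free_equiv" "(u' @ v, u' @ v') \<in> free_equiv"
    using free_equiv_context[OF assms(1), of "[]" v] free_equiv_context[OF assms(2), of u' "[]"]
    by simp_all
  then show ?thesis
    using equiv_free_equiv by (meson equivE transE)
qed

definition word_class :: "('a \<times> bool) list \<Rightarrow> ('a \<times> bool) list set" where
  "word_class u = free_equiv `` {u}"

lemma word_class_eq_iff: "word_class u = word_class v \<longleftrightarrow> (u, v) \<in> free_equiv"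
  unfolding word_class_def using equiv_free_equiv by (rule eq_equiv_class_iff) auto

lemma carrier_free_group: "carrier free_group = range word_class"
  by (auto simp: free_group_def word_class_def quotient_def)

lemma word_class_closed [simp]: "word_class u \<in> carrier free_group"
  by (simp add: carrier_free_group)

lemma one_free_group: "\<one>\<^bsub>free_group\<^esub> = word_class []"
  by (simp add: free_group_def word_class_def)

lemma mult_free_group: "word_class u \<otimes>\<^bsub>free_group\<^esub> word_class v = word_class (u @ v)"
proof -
  have "congruent2 free_equiv free_equiv (\<lambda>u v. free_equiv `` {u @ v})"
    using free_equiv_append
    by (auto simp: congruent2_def intro!: equiv_class_eq[OF equiv_free_equiv])
  from UN_equiv_class2[OF equiv_free_equiv equiv_free_equiv this] show ?thesis
    by (simp add: free_group_def word_class_def)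
qed

definition inverse_word :: "('a \<times> bool) list \<Rightarrow> ('a \<times> bool) list" where
  "inverse_word u = rev (map (\<lambda>(x, s). (x, \<not> s)) u)"

lemma inverse_word_append: "word_class (inverse_word u @ u) = word_class []"
proof (induction u)
  case (Cons l u)
  obtain x s where l: "l = (x, s)" by (cases l)
  \<comment> \<open>\<open>cancels.intros\<close> pairs a sign with its own negation, hence the
    double negation; the pair sits where the two words meet.\<close>
  have "cancels (inverse_word u @ [(x, \<not> s), (x, \<not> \<not> s)] @ u) (inverse_word u @ u)"
    by (rule cancels.intros)
  then have "word_class (inverse_word (l # u) @ l # u) = word_class (inverse_word u @ u)"
    unfolding word_class_eq_iff free_equiv_def l inverse_word_def by auto
  with Cons show ?case by simp
qed (simp add: inverse_word_def)

lemma group_free_group: "group free_group"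
proof (rule groupI)
  fix X :: "('a \<times> bool) list set" assume "X \<in> carrier free_group"
  then obtain u where "X = word_class u" by (auto simp: carrier_free_group)
  then show "\<exists>Y\<in>carrier free_group. Y \<otimes>\<^bsub>free_group\<^esub> X = \<one>\<^bsub>free_group\<^esub>"
    by (intro bexI[of _ "word_class (inverse_word u)"])
      (simp_all add: mult_free_group one_free_group inverse_word_append)
qed (auto simp: carrier_free_group one_free_group mult_free_group)

lemma free_gen_closed [simp]: "free_gen x \<in> carrier free_group"
  by (simp add: free_gen_def flip: word_class_def)

lemma word_class_single:
  "word_class [(x, s)] = (if s then free_gen x else inv\<^bsub>free_group\<^esub> (free_gen x))"
proof (cases s)
  case False
  have "word_class [(x, False)] \<otimes>\<^bsub>free_group\<^esub> free_gen x = \<one>\<^bsub>free_group\<^esub>"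
    using inverse_word_append[of "[(x, True)]"]
    by (simp add: free_gen_def mult_free_group one_free_group inverse_word_def flip: word_class_def)
  from group.inv_equality[OF group_free_group this] show ?thesis using False by simp
qed (simp add: free_gen_def word_class_def)

lemma word_class_Cons:
  "word_class ((x, s) # u) =
    (if s then free_gen x else inv\<^bsub>free_group\<^esub> (free_gen x)) \<otimes>\<^bsub>free_group\<^esub> word_class u"
  using mult_free_group[of "[(x, s)]" u] by (simp add: word_class_single)

section \<open>Evaluation of words and the universal property of the free group\<close>

definition eval_word :: "('h, 'b) monoid_scheme \<Rightarrow> ('a \<Rightarrow> 'h) \<Rightarrow> ('a \<times> bool) list \<Rightarrow> 'h" where
  "eval_word H \<gamma> u =
     foldr (\<lambda>(x, s) h. (if s then \<gamma> x else inv\<^bsub>H\<^esub> (\<gamma> x)) \<otimes>\<^bsub>H\<^esub> h) u \<one>\<^bsub>H\<^esub>"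

text \<open>When H is a group and \<gamma> takes values in its carrier, evaluation is constant on a
  class (\<open>eval_word_free_equiv\<close>), so \<open>the_elem\<close> is applied to a
  singleton.\<close>

definition free_lift :: "('h, 'b) monoid_scheme \<Rightarrow> ('a \<Rightarrow> 'h) \<Rightarrow> ('a \<times> bool) list set \<Rightarrow> 'h" where
  "free_lift H \<gamma> X = the_elem (eval_word H \<gamma> ` X)"

context group begin

lemma eval_word_closed:
  assumes "\<And>x. \<gamma> x \<in> carrier G" shows "eval_word G \<gamma> u \<in> carrier G"
  by (induction u) (auto simp: eval_word_def assms)

lemma eval_word_append:
  assumes "\<And>x. \<gamma> x \<in> carrier G"
  shows "eval_word G \<gamma> (u @ v) = eval_word G \<gamma> u \<otimes> eval_word G \<gamma> v"
proof (induction u)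
  case (Cons l u)
  obtain x s where "l = (x, s)" by (cases l)
  with Cons show ?case
    using eval_word_closed[of \<gamma>, OF assms] by (simp add: eval_word_def assms m_assoc)
qed (use eval_word_closed[of \<gamma>, OF assms] in \<open>simp add: eval_word_def\<close>)

lemma eval_word_free_equiv:
  assumes "\<And>x. \<gamma> x \<in> carrier G" "(u, v) \<in> free_equiv"
  shows "eval_word G \<gamma> u = eval_word G \<gamma> v"
proof -
  have *: "eval_word G \<gamma> u = eval_word G \<gamma> v" if "cancels u v" for u v
    using that
  proof cases
    case (1 w x s w')
    have "eval_word G \<gamma> [(x, s), (x, \<not> s)] = \<one>"
      using assms(1) by (cases s) (simp_all add: eval_word_def)
    then show ?thesis
      unfolding 1 eval_word_append[of \<gamma>, OF assms(1)]
      using eval_word_closed[of \<gamma>, OF assms(1)] by simp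
  qed
  have "equivclp cancels u v" using assms(2) by (simp add: free_equiv_def)
  then show ?thesis
    by (induction rule: equivclp_induct) (auto dest: *)
qed

lemma free_lift_word_class:
  assumes "\<And>x. \<gamma> x \<in> carrier G"
  shows "free_lift G \<gamma> (word_class u) = eval_word G \<gamma> u"
proof -
  have "u \<in> word_class u"
    unfolding word_class_def using equiv_free_equiv by (rule equiv_class_self) simp
  then have "eval_word G \<gamma> ` word_class u = {eval_word G \<gamma> u}"
    by (auto simp: word_class_def dest: eval_word_free_equiv[of \<gamma>, OF assms])
  then show ?thesis by (simp add: free_lift_def)
qed

lemma free_lift_hom:
  assumes "\<And>x. \<gamma> x \<in> carrier G"
  shows "free_lift G \<gamma> \<in> hom free_group G"
  by (rule homI)
    (auto simp: carrier_free_group mult_free_group free_lift_word_class[of \<gamma>, OF assms]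
      eval_word_closed[of \<gamma>, OF assms] eval_word_append[of \<gamma>, OF assms])

lemma free_lift_free_gen:
  assumes "\<And>x. \<gamma> x \<in> carrier G"
  shows "free_lift G \<gamma> (free_gen x) = \<gamma> x"
  using free_lift_word_class[of \<gamma> "[(x, True)]", OF assms] assms
  by (simp add: word_class_single eval_word_def)

text \<open>The hypothesis makes the whole group a member of the intersected family, so the
  intersection is over a nonempty family of subgroups; closure under conjugation passes to
  it.\<close>

lemma normal_closure_normal:
  assumes "R \<subseteq> carrier G" shows "normal_closure G R \<lhd> G"
proof -
  have "subgroup (normal_closure G R) G"
    unfolding normal_closure_def
    using assms normal_invI[OF subgroup_self]
    by (intro subgroups_Inter) (auto dest: normal_imp_subgroup)
  then show ?thesis
    unfolding normal_inv_iff by (auto simp: normal_closure_def normal_inv_iff)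
qed

lemma subset_normal_closure: "R \<subseteq> normal_closure G R"
  by (auto simp: normal_closure_def)

end

lemma relators_closed:
  assumes "rels \<subseteq> carrier free_group \<times> carrier free_group"
  shows "relators rels \<subseteq> carrier free_group"
proof -
  interpret F: group "free_group :: ('a \<times> bool) list set monoid" by (rule group_free_group)
  show ?thesis using assms by (auto simp: relators_def)
qed

section \<open>The quotient of the free group by its relators\<close>

locale presentation =
  fixes rels :: "(('a \<times> bool) list set \<times> ('a \<times> bool) list set) set"
  assumes rels: "rels \<subseteq> carrier free_group \<times> carrier free_group"
begin

sublocale F: group "free_group :: ('a \<times> bool) list set monoid" by (rule group_free_group)

sublocale N: normal "normal_closure free_group (relators rels)" free_group
  by (rule F.normal_closure_normal[OF relators_closed[OF rels]])

lemma group_presented_group: "group (presented_group rels)"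
  unfolding presented_group_def by (rule N.factorgroup_is_group)

definition proj :: "('a \<times> bool) list set \<Rightarrow> ('a \<times> bool) list set set" where
  "proj X = normal_closure free_group (relators rels) #>\<^bsub>free_group\<^esub> X"

lemma proj_hom: "proj \<in> hom free_group (presented_group rels)"
  using N.r_coset_hom_Mod by (simp add: presented_group_def proj_def[abs_def])

lemma proj_free_gen: "proj (free_gen x) = presented_gen rels x"
  by (simp add: proj_def presented_gen_def)

lemma proj_relation:
  assumes "(l, r) \<in> rels" shows "proj l = proj r"
proof -
  have lr: "l \<in> carrier free_group" "r \<in> carrier free_group" using assms rels by auto
  have "l \<otimes>\<^bsub>free_group\<^esub> inv\<^bsub>free_group\<^esub> r \<in> normal_closure free_group (relators rels)"
    using assms by (intro subsetD[OF F.subset_normal_closure]) (auto simp: relators_def)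
  then have "l \<in> proj r"
    unfolding proj_def using lr N.rcos_module_rev[OF F.is_group] by blast
  then show ?thesis
    unfolding proj_def using F.repr_independence lr N.is_subgroup by metis
qed

text \<open>Every element is the image of a word, and words grow on the left. This is how a set
  stable under left multiplication by generators and their inverses is shown to be
  everything.\<close>

lemma presented_group_induct [consumes 1, case_names one gen inv]:
  assumes "g \<in> carrier (presented_group rels)"
    and one: "P \<one>\<^bsub>presented_group rels\<^esub>"
    and gen: "\<And>x g. g \<in> carrier (presented_group rels) \<Longrightarrow> P g \<Longrightarrow>
      P (presented_gen rels x \<otimes>\<^bsub>presented_group rels\<^esub> g)"
    and inv: "\<And>x g. g \<in> carrier (presented_group rels) \<Longrightarrow> P g \<Longrightarrow>
      P (inv\<^bsub>presented_group rels\<^esub> (presented_gen rels x) \<otimes>\<^bsub>presented_group rels\<^esub> g)"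
  shows "P g"
proof -
  interpret p: group_hom free_group "presented_group rels" proj
    by (simp add: group_hom_def group_hom_axioms_def group_presented_group proj_hom group_free_group)
  have "P (proj (word_class u))" for u
  proof (induction u)
    case Nil
    then show ?case using one p.hom_one by (simp add: one_free_group)
  next
    case (Cons l u)
    obtain x s where "l = (x, s)" by (cases l)
    with Cons gen[of "proj (word_class u)" x] inv[of "proj (word_class u)" x] show ?case
      by (cases s) (simp_all add: word_class_Cons proj_free_gen)
  qed
  moreover obtain u where "g = proj (word_class u)"
    using assms(1) unfolding presented_group_def carrier_FactGroup carrier_free_group proj_def by auto
  ultimately show ?thesis by simp
qed

text \<open>The kernel of \<open>free_lift\<close> is normal and contains the relators, hence their
  normal closure, so the map factors through the quotient.\<close>

lemma von_Dyck:
  assumes H: "group H" and \<gamma>: "\<And>x. \<gamma> x \<in> carrier H"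
    and relations: "\<And>l r. (l, r) \<in> rels \<Longrightarrow> free_lift H \<gamma> l = free_lift H \<gamma> r"
  obtains h where "h \<in> hom (presented_group rels) H" "\<And>x. h (presented_gen rels x) = \<gamma> x"
proof -
  interpret H: group H by (rule H)
  interpret l: group_hom free_group H "free_lift H \<gamma>"
    by (simp add: group_hom_def group_hom_axioms_def group_free_group H H.free_lift_hom \<gamma>)
  have "relators rels \<subseteq> kernel free_group H (free_lift H \<gamma>)"
  proof
    fix x assume "x \<in> relators rels"
    then obtain l r where lr: "(l, r) \<in> rels" "x = l \<otimes>\<^bsub>free_group\<^esub> inv\<^bsub>free_group\<^esub> r"
      by (auto simp: relators_def)
    then show "x \<in> kernel free_group H (free_lift H \<gamma>)"
      using rels relations[OF lr(1)] by (auto simp: kernel_def)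
  qed
  then have "normal_closure free_group (relators rels) \<subseteq> kernel free_group H (free_lift H \<gamma>)"
    using l.normal_kernel unfolding normal_closure_def by auto
  then have trivial: "free_lift H \<gamma> n = \<one>\<^bsub>H\<^esub>"
    if "n \<in> normal_closure free_group (relators rels)" for n
    using that by (auto simp: kernel_def)
  have "free_lift H \<gamma> x = free_lift H \<gamma> y"
    if "x \<in> carrier free_group" "y \<in> carrier free_group" "proj x = proj y" for x y
  proof -
    have "x \<in> proj y" using that F.rcos_self N.is_subgroup unfolding proj_def by metis
    then obtain n where "n \<in> normal_closure free_group (relators rels)"
      "x = n \<otimes>\<^bsub>free_group\<^esub> y" by (auto simp: proj_def r_coset_def)
    then show ?thesis using that trivial[of n] N.subset by auto
  qed
  then obtain h where h: "h \<in> hom (presented_group rels) H"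
      "\<And>x. x \<in> carrier free_group \<Longrightarrow> h (proj x) = free_lift H \<gamma> x"
    using FactGroup_universal[OF l.homh N.normal_axioms]
    unfolding presented_group_def proj_def by metis
  show ?thesis
    using that[OF h(1)] h(2)[OF free_gen_closed] H.free_lift_free_gen[of \<gamma>, OF \<gamma>]
    by (simp add: proj_free_gen)
qed

end


section \<open>The field with \<open>q\<^sup>2\<close> elements\<close>

locale field_q2 =
  fixes p m q :: nat and \<zeta> :: "'k::{field, finite}"
  assumes prime_p: "prime p" and odd_p: "odd p" and m_pos: "m \<ge> 1" and q_eq: "q = p ^ m"
    and card_K: "CARD('k) = q\<^sup>2"
    and primitive: "primitive_element \<zeta>"
begin

lemma odd_q: "odd q"
  using odd_p q_eq by simp

lemma q_ge_3: "3 \<le> q"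
proof -
  have "1 < p" using prime_p by (rule prime_gt_1_nat)
  then have "q \<noteq> 0" "q \<noteq> 1" using m_pos by (auto simp: q_eq)
  moreover have "q \<noteq> 2" using odd_q by auto
  ultimately show ?thesis by linarith
qed

abbreviation n :: int where "n \<equiv> (int q)\<^sup>2 - 1"

lemma n_nat: "int (q\<^sup>2 - 1) = n"
  using q_ge_3 by (simp add: of_nat_diff)

lemma n_pos: "0 < n" "8 \<le> n"
proof -
  have "3 * 3 \<le> int q * int q" using q_ge_3 by (intro mult_mono) auto
  then show "8 \<le> n" by (simp add: power2_eq_square)
  then show "0 < n" by simp
qed

lemma half_q: obtains t where "int q = 2 * t + 1"
  using odd_q by (metis oddE of_nat_add of_nat_mult of_nat_1 of_nat_numeral)

text \<open>With q = 2 t + 1 one has q^2 - 1 = 4 t (t + 1). The factor 4 makes n/2 even, so that -1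
  is a square and a shift of an exponent by n/2 preserves its parity.\<close>

lemma four_dvd_n: "4 dvd n"
proof -
  obtain t where "int q = 2 * t + 1" by (rule half_q)
  then have "n = 4 * (t * t + t)" by (simp add: power2_eq_square algebra_simps)
  then show ?thesis by simp
qed

lemma even_n: "even n"
  using four_dvd_n by presburger

text \<open>The characteristic is a prime dividing the number q^2 of field elements, so it is p, and
  q is a power of it.\<close>

lemma frob_add: "frob q (x + y) = frob q x + frob q (y :: 'k)"
proof -
  have "CHAR('k) dvd q\<^sup>2" using CHAR_dvd_CARD[where 'a='k] by (simp add: card_K)
  moreover have prime_CHAR: "prime CHAR('k)"
    using prime_CHAR_semidom finite_imp_CHAR_pos[where 'a='k] by auto
  ultimately have "CHAR('k) dvd p"
    using prime_CHAR by (metis q_eq prime_dvd_power)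
  then have "CHAR('k) = p"
    using prime_p prime_CHAR by (simp add: primes_dvd_imp_eq)
  then show ?thesis
    using freshmans_dream'[of q m x y] prime_p by (simp add: q_eq frob_def)
qed

lemma zeta_nonzero: "\<zeta> \<noteq> 0"
  using primitive by (force simp: primitive_element_def intro: exI[of _ "1::nat"])

lemma nonzero_eq_zeta_power:
  assumes "x \<noteq> 0" obtains k :: nat where "x = \<zeta> ^ k"
  using assms primitive by (auto simp: primitive_element_def)

text \<open>Powers of \<zeta> repeat, which gives a least positive period d. The powers with
  exponent below d are distinct and exhaust the nonzero elements, of which there are q^2 -
  1.\<close>

lemma zeta_order: "\<zeta> ^ k = 1 \<longleftrightarrow> q\<^sup>2 - 1 dvd k"
proof -
  have "\<not> inj (\<lambda>k::nat. \<zeta> ^ k)"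
    using finite_imageD[of "\<lambda>k::nat. \<zeta> ^ k" UNIV] by auto
  then obtain i j where "i < j" "\<zeta> ^ i = \<zeta> ^ j"
    unfolding inj_def by (metis linorder_neqE_nat)
  then have "\<zeta> ^ (j - i) = 1" "0 < j - i" using zeta_nonzero
    by (simp_all add: power_diff)
  then obtain d where d: "0 < d" "\<zeta> ^ d = 1" and least: "\<And>e. 0 < e \<Longrightarrow> e < d \<Longrightarrow> \<zeta> ^ e \<noteq> 1"
    using exists_least_iff[of "\<lambda>d. 0 < d \<and> \<zeta> ^ d = 1"] by metis
  have reduce: "\<zeta> ^ k = \<zeta> ^ (k mod d)" for k
    by (metis d(2) div_mult_mod_eq mult.commute mult_1 power_add power_mult power_one)
  have iff: "\<zeta> ^ k = 1 \<longleftrightarrow> d dvd k" for k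
    using reduce[of k] least[of "k mod d"] d(1) by (auto simp: dvd_eq_mod_eq_0)
  have inj: "inj_on (\<lambda>k. \<zeta> ^ k) {..<d}"
  proof (rule linorder_inj_onI)
    fix i j assume "i < j" "i \<in> {..<d}" "j \<in> {..<d}"
    then have "\<zeta> ^ (j - i) \<noteq> 1" using least[of "j - i"] by auto
    with \<open>i < j\<close> show "\<zeta> ^ i \<noteq> \<zeta> ^ j" using zeta_nonzero by (simp add: power_diff)
  qed auto
  have "(\<lambda>k. \<zeta> ^ k) ` {..<d} = {x. x \<noteq> 0}"
  proof -
    have "\<exists>k<d. x = \<zeta> ^ k" if "x \<noteq> 0" for x
      using that nonzero_eq_zeta_power[of x] reduce d(1) by (metis mod_less_divisor)
    then show ?thesis using zeta_nonzero by auto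
  qed
  then have "d = card {x::'k. x \<noteq> 0}" using card_image[OF inj] by simp
  also have "{x::'k. x \<noteq> 0} = UNIV - {0}" by auto
  also have "card \<dots> = q\<^sup>2 - 1" by (simp add: card_K card_Diff_singleton)
  finally show ?thesis using iff by simp
qed

lemma zeta_powi_eq_1: "\<zeta> powi k = 1 \<longleftrightarrow> n dvd k"
proof (cases "k \<ge> 0")
  case True
  then have "\<zeta> powi k = \<zeta> ^ nat k" by (simp add: power_int_def)
  then show ?thesis using True n_nat zeta_order[of "nat k"]
    by (metis int_dvd_int_iff int_nat_eq)
next
  case False
  then have "\<zeta> powi k = inverse (\<zeta> ^ nat (- k))" by (simp add: power_int_def power_inverse)
  then have "\<zeta> powi k = 1 \<longleftrightarrow> q\<^sup>2 - 1 dvd nat (- k)" using zeta_order[of "nat (-k)"] by simp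
  also have "\<dots> \<longleftrightarrow> n dvd - k" using False n_nat
    by (metis int_dvd_int_iff int_nat_eq linorder_not_le neg_0_le_iff_le nle_le)
  finally show ?thesis by simp
qed

lemma zeta_powi_eq_iff: "\<zeta> powi k = \<zeta> powi l \<longleftrightarrow> n dvd k - l"
  using zeta_powi_eq_1[of "k - l"] zeta_nonzero by (simp add: power_int_diff)

lemma zeta_powi_half: "\<zeta> powi (n div 2) = - 1"
proof -
  obtain h where h: "n = h * 2" using even_n by (metis evenE mult.commute)
  then have "\<not> n dvd h" using n_pos zdvd_imp_le[of n h] by linarith
  then have "\<zeta> powi h \<noteq> 1" by (simp add: zeta_powi_eq_1)
  moreover have "(\<zeta> powi h)\<^sup>2 = \<zeta> powi n" unfolding h by (simp add: power_int_mult)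
  moreover have "\<zeta> powi n = 1" by (simp add: zeta_powi_eq_1)
  ultimately show ?thesis by (simp add: h power2_eq_1_iff)
qed

text \<open>Exponents are determined modulo the even number n, so their parity depends only on the
  power of \<zeta>.\<close>

lemma unit_square_zeta_powi: "unit_square (\<zeta> powi k) \<longleftrightarrow> even k"
proof
  assume "unit_square (\<zeta> powi k)"
  then obtain y where y: "y \<noteq> 0" "\<zeta> powi k = y\<^sup>2" by (auto simp: unit_square_def)
  then obtain l where "y = \<zeta> ^ l" using nonzero_eq_zeta_power by blast
  then have "\<zeta> powi k = \<zeta> powi (int l * 2)"
    using y(2) by (simp add: power_int_mult)
  then have "2 dvd k - int l * 2"
    using even_n unfolding zeta_powi_eq_iff by (meson dvd_trans)
  then show "even k" by simp
next
  assume "even k"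
  then obtain l where "k = l * 2" by (metis evenE mult.commute)
  then have "\<zeta> powi k = (\<zeta> powi l)\<^sup>2" by (simp add: power_int_mult)
  then show "unit_square (\<zeta> powi k)" 
    using zeta_nonzero unfolding unit_square_def by (metis power_int_eq_0_iff)
qed

lemma nonzero_eq_zeta_powi:
  assumes "x \<noteq> 0" obtains k where "x = \<zeta> powi k"
  using nonzero_eq_zeta_power[OF assms] by (metis power_int_of_nat)

text \<open>Squares are the powers with even exponent, and exponents add. This is the index-two
  character that governs the twist.\<close>

lemma unit_square_mult:
  assumes "x \<noteq> 0" "(y::'k) \<noteq> 0"
  shows "unit_square (x * y) \<longleftrightarrow> (unit_square x \<longleftrightarrow> unit_square y)"
proof -
  obtain k l where "x = \<zeta> powi k" "y = \<zeta> powi l"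
    using assms nonzero_eq_zeta_powi by metis
  moreover from this have "x * y = \<zeta> powi (k + l)" using zeta_nonzero by (simp add: power_int_add)
  ultimately show ?thesis by (simp add: unit_square_zeta_powi)
qed

lemma frob_hom [simp]:
  "frob q (0::'k) = 0" "frob q (1::'k) = 1"
  "frob q (x * y) = frob q x * frob q (y::'k)"
  "frob q (x / y) = frob q x / frob q (y::'k)"
  "frob q (x - y) = frob q x - frob q (y::'k)"
  "frob q (- x) = - frob q (x::'k)"
proof -
  show "frob q (x - y) = frob q x - frob q (y::'k)" for x y
    using frob_add[of "x - y" y] by simp
  show "frob q (- x) = - frob q (x::'k)" for x
    using odd_q by (simp add: frob_def)
qed (use q_ge_3 in \<open>simp_all add: frob_def power_mult_distrib power_divide\<close>)

lemma frob_zeta_powi: "frob q (\<zeta> powi k) = \<zeta> powi (int q * k)"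
  by (simp add: frob_def mult.commute power_int_mult)

lemma frob_frob [simp]: "frob q (frob q x) = (x::'k)"
proof (cases "x = 0")
  case False
  then obtain k where k: "x = \<zeta> powi k" using nonzero_eq_zeta_powi by blast
  have "int q * (int q * k) - k = n * k" by (simp add: power2_eq_square algebra_simps)
  then show ?thesis
    using zeta_powi_eq_iff[of "int q * (int q * k)" k] by (simp add: k frob_zeta_powi)
qed simp

lemma frob_eq_0_iff [simp]: "frob q (x::'k) = 0 \<longleftrightarrow> x = 0"
  using q_ge_3 by (simp add: frob_def)

lemma unit_square_frob [simp]: "unit_square (frob q x) \<longleftrightarrow> unit_square (x::'k)"
proof (cases "x = 0")
  case False
  then obtain k where k: "x = \<zeta> powi k" using nonzero_eq_zeta_powi by blast
  then show ?thesis using odd_q by (simp add: frob_zeta_powi unit_square_zeta_powi)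
qed simp

end


section \<open>Twisted Moebius transformations\<close>

lemma matrix_mult_2:
  fixes A B :: "'k::field ^ 2 ^ 2"
  shows "(A ** B) $ i $ j = A $ i $ 1 * B $ 1 $ j + A $ i $ 2 * B $ 2 $ j"
  by (simp add: matrix_matrix_mult_def sum_2)

lemma mat_2:
  "(mat c :: 'k::field ^ 2 ^ 2) $ 1 $ 1 = c" "(mat c :: 'k ^ 2 ^ 2) $ 1 $ 2 = 0"
  "(mat c :: 'k ^ 2 ^ 2) $ 2 $ 1 = 0" "(mat c :: 'k ^ 2 ^ 2) $ 2 $ 2 = c"
  by (simp_all add: mat_def)

lemma matrix_eq_2:
  fixes A B :: "'k::field ^ 2 ^ 2"
  shows "A = B \<longleftrightarrow> A$1$1 = B$1$1 \<and> A$1$2 = B$1$2 \<and> A$2$1 = B$2$1 \<and> A$2$2 = B$2$2"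
  by (auto simp: vec_eq_iff forall_2)

lemma det_mat_2: "det (mat c :: 'k::field ^ 2 ^ 2) = c\<^sup>2"
  by (simp add: det_2 mat_2 power2_eq_square)

lemma mat_mult_2:
  fixes A :: "'k::field ^ 2 ^ 2"
  shows "(mat c ** A) $ i $ j = c * A $ i $ j" "(A ** mat c) $ i $ j = c * A $ i $ j"
  using exhaust_2[of i] exhaust_2[of j] by (auto simp: matrix_mult_2 mat_2)

text \<open>Homogeneous coordinates absorb the point at infinity: \<open>key\<close> gives the
  effect of A on the point with coordinates (x, y), and B sends the coordinates of w to a nonzero
  vector because its determinant does not vanish.\<close>

lemma moebius_mult:
  fixes A B :: "'k::field ^ 2 ^ 2"
  assumes "det A \<noteq> 0" "det B \<noteq> 0"
  shows "moebius (A ** B) = moebius A \<circ> moebius B"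
proof
  fix w
  define a b c d where "a = A$1$1" "b = A$1$2" "c = A$2$1" "d = A$2$2"
  define e f g h where "e = B$1$1" "f = B$1$2" "g = B$2$1" "h = B$2$2"
  note ABs = a_b_c_d_def[symmetric] e_f_g_h_def[symmetric]
  have A: "a * d - b * c \<noteq> 0" using assms(1) by (simp add: det_2 ABs)
  have B: "e * h - f * g \<noteq> 0" using assms(2) by (simp add: det_2 ABs)
  have key: "moebius A (if y = 0 then None else Some (x / y)) =
      (if c * x + d * y = 0 then None else Some ((a * x + b * y) / (c * x + d * y)))"
    if "x \<noteq> 0 \<or> y \<noteq> 0" for x y
  proof (cases "y = 0")
    case True
    with that show ?thesis by (simp add: moebius_def ABs)
  next
    case False
    then have "c * (x / y) + d = (c * x + d * y) / y" "a * (x / y) + b = (a * x + b * y) / y"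
      by (simp_all add: add_divide_distrib)
    with False show ?thesis by (simp add: moebius_def ABs)
  qed
  show "moebius (A ** B) w = (moebius A \<circ> moebius B) w"
  proof (cases w)
    case None
    have "e \<noteq> 0 \<or> g \<noteq> 0" using B by auto
    moreover have "moebius B w = (if g = 0 then None else Some (e / g))"
      by (simp add: None moebius_def ABs)
    ultimately have "(moebius A \<circ> moebius B) w =
      (if c * e + d * g = 0 then None else Some ((a * e + b * g) / (c * e + d * g)))"
      using key by simp
    then show ?thesis
      by (simp add: None moebius_def[of "A ** B"] matrix_mult_2 ABs)
  next
    case (Some z)
    have "e * z + f \<noteq> 0 \<or> g * z + h \<noteq> 0"
    proof (rule ccontr)
      assume *: "\<not> ?thesis"
      \<comment> \<open>The combination of the two coordinates that eliminates z and leaves the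
        determinant.\<close>
      have "e * h - f * g = e * (g * z + h) - g * (e * z + f)" by (simp add: algebra_simps)
      then show False using * B by simp
    qed
    moreover have "moebius B w =
        (if g * z + h = 0 then None else Some ((e * z + f) / (g * z + h)))"
      by (simp add: Some moebius_def ABs)
    ultimately have "(moebius A \<circ> moebius B) w =
      (if c * (e * z + f) + d * (g * z + h) = 0 then None
       else Some ((a * (e * z + f) + b * (g * z + h)) / (c * (e * z + f) + d * (g * z + h))))"
      using key by simp
    then show ?thesis
      by (simp add: Some moebius_def[of "A ** B"] matrix_mult_2 ABs algebra_simps)
  qed
qed

lemma moebius_mat:
  assumes "c \<noteq> 0" shows "moebius (mat c :: 'k::field ^ 2 ^ 2) = id"
  using assms by (auto simp: moebius_def mat_2 fun_eq_iff split: option.split)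

lemma moebius_inverse:
  fixes A :: "'k::field ^ 2 ^ 2"
  assumes "det A \<noteq> 0"
  obtains B where "det B \<noteq> 0" "A ** B = mat 1" "B ** A = mat 1"
    "moebius A \<circ> moebius B = id" "moebius B \<circ> moebius A = id"
proof -
  obtain B where B: "A ** B = mat 1" "B ** A = mat 1"
    using assms invertible_det_nz[of A] unfolding invertible_def by auto
  have "det (A ** B) = 1" by (simp add: B)
  then have "det B \<noteq> 0" by (auto simp: det_mul)
  with B assms that moebius_mult[of A B] moebius_mult[of B A] moebius_mat[of "1 :: 'k"]
  show ?thesis by simp
qed

text \<open>Fixing \<infinity> kills the lower left entry, fixing 0 the upper right one, and fixing
  1 equates the diagonal entries.\<close>

lemma moebius_fixing_three_points:
  fixes A :: "'k::field ^ 2 ^ 2"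
  assumes "det A \<noteq> 0"
    and "moebius A None = None" "moebius A (Some 0) = Some 0" "moebius A (Some 1) = Some 1"
  obtains c where "c \<noteq> 0" "A = mat c"
proof -
  have "A$2$1 = 0" using assms(2) by (simp add: moebius_def split: if_splits)
  moreover have "A$2$2 \<noteq> 0" using assms(1) \<open>A$2$1 = 0\<close> by (auto simp: det_2)
  moreover have "A$1$2 = 0"
    using assms(3) \<open>A$2$2 \<noteq> 0\<close> by (simp add: moebius_def split: if_splits)
  moreover have "A$1$1 = A$2$2"
    using assms(4) calculation by (simp add: moebius_def split: if_splits)
  ultimately show ?thesis using that[of "A$2$2"] by (simp add: matrix_eq_2 mat_2)
qed

lemma moebius_eq_three_points:
  fixes A B :: "'k::field ^ 2 ^ 2"
  assumes "det A \<noteq> 0" "det B \<noteq> 0" "\<And>w. w \<in> {None, Some 0, Some 1} \<Longrightarrow> moebius A w = moebius B w"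
  obtains c where "c \<noteq> 0" "A = mat c ** B"
proof -
  obtain C where C: "det C \<noteq> 0" "B ** C = mat 1" "moebius C \<circ> moebius B = id"
    using moebius_inverse[OF assms(2)] by metis
  have "moebius (C ** A) w = w" if "w \<in> {None, Some 0, Some 1}" for w
    using assms(3)[OF that] C(3) by (simp add: moebius_mult assms C(1) fun_eq_iff)
  moreover have "det (C ** A) \<noteq> 0" using assms C by (simp add: det_mul)
  ultimately obtain c where c: "c \<noteq> 0" "C ** A = mat c"
    using moebius_fixing_three_points[of "C ** A"] by auto
  have "A = B ** (C ** A)" by (simp add: matrix_mul_assoc C(2))
  also have "\<dots> = mat c ** B" by (simp add: c matrix_eq_2 mat_mult_2)
  finally show ?thesis using that c(1) by blast
qed

section \<open>Projective classes of matrices\<close>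

lemma group_GL2: "group (GL2 :: ('k::field ^ 2 ^ 2) monoid)"
proof (rule groupI)
  fix A :: "'k ^ 2 ^ 2" assume "A \<in> carrier GL2"
  then show "\<exists>B\<in>carrier GL2. B \<otimes>\<^bsub>GL2\<^esub> A = \<one>\<^bsub>GL2\<^esub>"
    using moebius_inverse[of A] by (auto simp: GL2_def)
qed (auto simp: GL2_def det_mul matrix_mul_assoc)

text \<open>Scalar matrices are central, so conjugation fixes each of them.\<close>

lemma scalars2_normal: "scalars2 \<lhd> (GL2 :: ('k::field ^ 2 ^ 2) monoid)"
proof -
  interpret GL2: group "GL2 :: ('k ^ 2 ^ 2) monoid" by (rule group_GL2)
  have scalar: "mat c \<in> scalars2 \<longleftrightarrow> c \<noteq> 0" for c :: 'k
    by (auto simp: scalars2_def matrix_eq_2 mat_2)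
  have mult: "mat c ** mat d = (mat (c * d) :: 'k ^ 2 ^ 2)" for c d
    by (simp add: matrix_eq_2 mat_mult_2 mat_2)
  have "subgroup scalars2 (GL2 :: ('k ^ 2 ^ 2) monoid)"
  proof (rule GL2.subgroupI)
    fix A :: "'k ^ 2 ^ 2" assume "A \<in> scalars2"
    then obtain c where c: "c \<noteq> 0" "A = mat c" by (auto simp: scalars2_def)
    have "inv\<^bsub>GL2\<^esub> A = mat (inverse c)"
      using c by (intro GL2.inv_equality) (simp_all add: GL2_def det_mat_2 mult)
    with c show "inv\<^bsub>GL2\<^esub> A \<in> scalars2" by (simp add: scalar)
  next
    fix A B :: "'k ^ 2 ^ 2" assume "A \<in> scalars2" "B \<in> scalars2"
    then obtain c d where "c \<noteq> 0" "A = mat c" "d \<noteq> 0" "B = mat d" by (auto simp: scalars2_def)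
    then show "A \<otimes>\<^bsub>GL2\<^esub> B \<in> scalars2" by (simp add: GL2_def mult scalar)
  qed (auto simp: scalars2_def GL2_def det_mat_2 intro: exI[of _ 1])
  moreover have "A \<otimes>\<^bsub>GL2\<^esub> S \<otimes>\<^bsub>GL2\<^esub> inv\<^bsub>GL2\<^esub> A \<in> scalars2"
    if A: "A \<in> carrier GL2" and S: "S \<in> scalars2" for A S :: "'k ^ 2 ^ 2"
  proof -
    obtain c where c: "c \<noteq> 0" "S = mat c" using S by (auto simp: scalars2_def)
    then have "S \<in> carrier GL2" by (simp add: GL2_def det_mat_2)
    have "A \<otimes>\<^bsub>GL2\<^esub> S = S \<otimes>\<^bsub>GL2\<^esub> A"
      by (simp add: GL2_def c matrix_eq_2 mat_mult_2)
    then show ?thesis using A S \<open>S \<in> carrier GL2\<close> by (simp add: GL2.m_assoc)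
  qed
  ultimately show ?thesis by (auto simp: GL2.normal_inv_iff)
qed

definition pclass :: "'k::field ^ 2 ^ 2 \<Rightarrow> ('k ^ 2 ^ 2) set" where
  "pclass A = scalars2 #>\<^bsub>GL2\<^esub> A"

lemma pclass_eq: "pclass A = {mat c ** A |c. c \<noteq> 0}"
  by (auto simp: pclass_def r_coset_def scalars2_def GL2_def)

lemma self_in_pclass: "A \<in> pclass A"
  unfolding pclass_eq by (auto simp: matrix_eq_2 mat_mult_2 intro!: exI[of _ 1])

lemma pclass_scale:
  assumes "c \<noteq> 0" shows "pclass (mat c ** A) = pclass A"
proof (intro subset_antisym subsetI)
  fix X assume "X \<in> pclass (mat c ** A)"
  then obtain d where "d \<noteq> 0" "X = mat d ** (mat c ** A)" unfolding pclass_eq by blast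
  then have "d * c \<noteq> 0" "X = mat (d * c) ** A"
    using assms by (simp_all add: matrix_eq_2 mat_mult_2)
  then show "X \<in> pclass A" unfolding pclass_eq by blast
next
  fix X assume "X \<in> pclass A"
  then obtain d where "d \<noteq> 0" "X = mat d ** A" unfolding pclass_eq by blast
  then have "d / c \<noteq> 0" "X = mat (d / c) ** (mat c ** A)"
    using assms by (simp_all add: matrix_eq_2 mat_mult_2)
  then show "X \<in> pclass (mat c ** A)" unfolding pclass_eq by blast
qed

lemma carrier_PGL2: "carrier PGL2 = {pclass A |A. det A \<noteq> 0}"
  by (auto simp: PGL2_def carrier_FactGroup pclass_def GL2_def)

lemma mult_PGL2:
  assumes "det A \<noteq> 0" "det B \<noteq> 0"
  shows "pclass A \<otimes>\<^bsub>PGL2\<^esub> pclass B = pclass (A ** B)"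
  using normal.rcos_sum[OF scalars2_normal, of A B] assms
  by (simp add: PGL2_def pclass_def GL2_def)

lemma one_PGL2: "\<one>\<^bsub>PGL2\<^esub> = pclass (mat 1)"
proof -
  have "mat c ** mat 1 = (mat c :: 'a ^ 2 ^ 2)" for c
    by (simp add: matrix_eq_2 mat_mult_2 mat_2)
  then show ?thesis by (auto simp: PGL2_def pclass_eq scalars2_def)
qed

text \<open>Scaling a 2 by 2 matrix by c multiplies its determinant by c^2; thus the choice between
  identity and Frobenius depends on the projective class only.\<close>

lemma unit_square_scale:
  assumes "c \<noteq> (0::'k::field)" shows "unit_square (c\<^sup>2 * x) \<longleftrightarrow> unit_square x"
proof
  assume "unit_square (c\<^sup>2 * x)"
  then obtain y where "y \<noteq> 0" "c\<^sup>2 * x = y\<^sup>2" by (auto simp: unit_square_def)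
  then have "x = (y / c)\<^sup>2" "y / c \<noteq> 0" using assms by (simp_all add: power_divide field_simps)
  then show "unit_square x" unfolding unit_square_def by blast
next
  assume "unit_square x"
  then obtain y where "y \<noteq> 0" "x = y\<^sup>2" by (auto simp: unit_square_def)
  then have "c\<^sup>2 * x = (c * y)\<^sup>2" "c * y \<noteq> 0" using assms by (simp_all add: power_mult_distrib)
  then show "unit_square (c\<^sup>2 * x)" unfolding unit_square_def by blast
qed

lemma twisted_moebius_scale:
  assumes "c \<noteq> 0" "det A \<noteq> 0"
  shows "twisted_moebius q (mat c ** A) = twisted_moebius q A"
  using assms by (simp add: twisted_moebius_def det_mul det_mat_2 unit_square_scale
      moebius_mult moebius_mat fun_eq_iff)

lemma phi_bar_pclass:
  "phi_bar q (pclass A) =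
     (if unit_square (det A) then (\<lambda>Y. Y) else (\<lambda>Y. map_matrix (frob q) ` Y))"
proof -
  have "(\<exists>B\<in>pclass A. unit_square (det B)) \<longleftrightarrow> unit_square (det A)"
    using self_in_pclass[of A]
    by (auto simp: pclass_eq det_mul det_mat_2 unit_square_scale simp del: ex_simps)
  then show ?thesis by (simp add: phi_bar_def)
qed

lemma M_group_simps:
  "carrier (M_group q) = {h. bij h \<and> (\<exists>A. det A \<noteq> 0 \<and> h = twisted_moebius q A)}"
  "g \<in> carrier (M_group q) \<Longrightarrow> h \<in> carrier (M_group q) \<Longrightarrow> g \<otimes>\<^bsub>M_group q\<^esub> h = g \<circ> h"
  "\<one>\<^bsub>M_group q\<^esub> = id"
  by (auto simp: M_group_def BijGroup_def Bij_def compose_def fun_eq_iff)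

section \<open>Composition of twisted maps, and the two isomorphic groups\<close>

context field_q2 begin

text \<open>The automorphism \<beta> belonging to A, as a map on K. It is an involution and thus
  serves as its own inverse.\<close>

definition twist :: "'k ^ 2 ^ 2 \<Rightarrow> 'k \<Rightarrow> 'k" where
  "twist A = (if unit_square (det A) then (\<lambda>x. x) else frob q)"

lemma twisted_moebius_eq: "twisted_moebius q A = moebius A \<circ> map_option (twist A)"
  by (simp add: twisted_moebius_def twist_def option.map_id0[unfolded id_def])

lemma twist_hom [simp]:
  "twist A 0 = 0" "twist A 1 = 1" "twist A (x * y) = twist A x * twist A y"
  "twist A (x / y) = twist A x / twist A y" "twist A (x - y) = twist A x - twist A y"
  "twist A (x + y) = twist A x + twist A y"
  "twist A (twist A x) = x" "twist A x = 0 \<longleftrightarrow> x = 0"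
  "unit_square (twist A x) \<longleftrightarrow> unit_square x"
  by (simp_all add: twist_def frob_add)

lemma det_twist [simp]: "det (map_matrix (twist A) B :: 'k ^ 2 ^ 2) = twist A (det B)"
  by (simp add: det_2)

lemma map_matrix_twist [simp]: "map_matrix (twist A) (map_matrix (twist A) B) = (B :: 'k ^ 2 ^ 2)"
  by (simp add: matrix_eq_2)

lemma moebius_twist:
  "map_option (twist A) (moebius B w) = moebius (map_matrix (twist A) B) (map_option (twist A) w)"
proof -
  have [simp]: "x \<noteq> 0 \<Longrightarrow> twist A x \<noteq> 0" for x by simp
  show ?thesis
    by (cases w) (auto simp: moebius_def simp flip: twist_hom(3,6) simp del: twist_hom(3,6))
qed

text \<open>Twisting preserves square classes, so the determinant of the product is a square exactly
  when det A and det B are both squares or both nonsquares; in the latter case the two Frobenius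
  maps cancel.\<close>

lemma twist_mult:
  assumes "det A \<noteq> 0" "det B \<noteq> 0"
  shows "twist (A ** map_matrix (twist A) B) = twist A \<circ> twist B"
  using unit_square_mult[of "det A" "twist A (det B)"] assms
  by (simp add: fun_eq_iff twist_def[of "A ** _"] det_mul) (simp add: twist_def)

text \<open>Moving the twist of A past the Moebius map of B replaces B by its entrywise image; then
  the matrices multiply and the twists compose.\<close>

lemma twisted_moebius_mult:
  assumes "det A \<noteq> 0" "det B \<noteq> 0"
  shows "twisted_moebius q A \<circ> twisted_moebius q B =
    twisted_moebius q (A ** map_matrix (twist A) B)"
proof
  fix w
  show "(twisted_moebius q A \<circ> twisted_moebius q B) w =
    twisted_moebius q (A ** map_matrix (twist A) B) w"
    using assms
    by (simp add: twisted_moebius_eq moebius_twist moebius_mult option.map_comp o_def twist_mult)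
qed

lemma bij_twisted_moebius:
  fixes A :: "'k ^ 2 ^ 2"
  assumes "det A \<noteq> 0" shows "bij (twisted_moebius q A)"
proof -
  obtain B where "moebius A \<circ> moebius B = id" "moebius B \<circ> moebius A = id"
    using moebius_inverse[OF assms] by metis
  then have "bij (moebius A)" by (rule o_bij[rotated])
  moreover have "map_option (twist A) \<circ> map_option (twist A) = id"
    by (simp add: fun_eq_iff option.map_comp o_def option.map_ident)
  then have "bij (map_option (twist A))" by (metis o_bij)
  ultimately show ?thesis unfolding twisted_moebius_eq by (rule bij_comp[rotated])
qed

lemma carrier_M_group: "carrier (M_group q) = {twisted_moebius q A |A :: 'k ^ 2 ^ 2. det A \<noteq> 0}"
  by (auto simp: M_group_simps bij_twisted_moebius)

lemma twisted_moebius_mat: "c \<noteq> 0 \<Longrightarrow> twisted_moebius q (mat c) = id"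
  by (auto simp: twisted_moebius_def det_mat_2 moebius_mat unit_square_def fun_eq_iff)

lemma group_M_group: "group (M_group q :: ('k option \<Rightarrow> 'k option) monoid)"
proof (rule groupI)
  have closed: "twisted_moebius q A \<circ> twisted_moebius q B \<in> carrier (M_group q)"
    if "det A \<noteq> 0" "det B \<noteq> 0" for A B :: "'k ^ 2 ^ 2"
    using that unfolding twisted_moebius_mult[OF that] carrier_M_group
    by (auto simp: det_mul intro!: exI[of _ "A ** map_matrix (twist A) B"])
  show mult: "g \<otimes>\<^bsub>M_group q\<^esub> h \<in> carrier (M_group q)"
    if "g \<in> carrier (M_group q)" "h \<in> carrier (M_group q)" for g h :: "'k option \<Rightarrow> 'k option"
    using that closed by (auto simp: M_group_simps(2)) (auto simp: carrier_M_group)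
  show one: "\<one>\<^bsub>M_group q\<^esub> \<in> carrier (M_group q :: ('k option \<Rightarrow> 'k option) monoid)"
  proof -
    have "id = twisted_moebius q (mat 1)" "det (mat 1 :: 'k ^ 2 ^ 2) \<noteq> 0"
      by (simp_all add: twisted_moebius_mat)
    then show ?thesis unfolding carrier_M_group M_group_simps(3) by blast
  qed
  show "g \<otimes>\<^bsub>M_group q\<^esub> h \<otimes>\<^bsub>M_group q\<^esub> k = g \<otimes>\<^bsub>M_group q\<^esub> (h \<otimes>\<^bsub>M_group q\<^esub> k)"
    if "g \<in> carrier (M_group q)" "h \<in> carrier (M_group q)" "k \<in> carrier (M_group q)"
    for g h k :: "'k option \<Rightarrow> 'k option"
    using mult[OF that(1,2)] mult[OF that(2,3)] that by (simp add: M_group_simps(2) o_assoc)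
  show "\<one>\<^bsub>M_group q\<^esub> \<otimes>\<^bsub>M_group q\<^esub> g = g" if "g \<in> carrier (M_group q)" for g :: "'k option \<Rightarrow> 'k option"
    using that one by (simp add: M_group_simps(2)) (simp add: M_group_simps(3))
  show "\<exists>h\<in>carrier (M_group q). h \<otimes>\<^bsub>M_group q\<^esub> g = \<one>\<^bsub>M_group q\<^esub>"
    if g: "g \<in> carrier (M_group q)" for g :: "'k option \<Rightarrow> 'k option"
  proof -
    obtain A where A: "det A \<noteq> 0" "g = twisted_moebius q A" using g by (auto simp: carrier_M_group)
    then obtain C where C: "det C \<noteq> 0" "A ** C = mat 1"
      using moebius_inverse by metis
    \<comment> \<open>The product with A twists its right factor once more, so the inverse matrix is
      twisted in advance.\<close>
    define B where "B = map_matrix (twist A) C"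
    have "twisted_moebius q A \<circ> twisted_moebius q B = id"
      using twisted_moebius_mult[of A B] A C twisted_moebius_mat[of 1] by (simp add: B_def)
    \<comment> \<open>A right inverse of a bijection is also a left inverse.\<close>
    then have "twisted_moebius q B \<circ> g = id"
      using bij_twisted_moebius[OF A(1)] A(2)
      by (metis bij_betw_def inv_unique_comp o_inv_o_cancel inj_iff comp_assoc comp_id id_comp)
    moreover have "twisted_moebius q B \<in> carrier (M_group q)"
      using C by (auto simp: carrier_M_group B_def intro!: exI[of _ "map_matrix (twist A) C"])
    ultimately show ?thesis using g by (auto simp: M_group_simps(2,3))
  qed
qed

lemma map_matrix_pclass: "map_matrix (twist A) ` pclass B = pclass (map_matrix (twist A) B)"
proof -
  have *: "map_matrix (twist A) (mat c ** B) = mat (twist A c) ** map_matrix (twist A) B" for c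
    by (simp add: matrix_eq_2 mat_mult_2)
  show ?thesis
  proof (intro subset_antisym subsetI)
    fix X assume "X \<in> map_matrix (twist A) ` pclass B"
    then obtain c where "c \<noteq> 0" "X = map_matrix (twist A) (mat c ** B)" unfolding pclass_eq by blast
    then have "twist A c \<noteq> 0" "X = mat (twist A c) ** map_matrix (twist A) B"
      by (simp_all add: *)
    then show "X \<in> pclass (map_matrix (twist A) B)" unfolding pclass_eq by blast
  next
    fix X assume "X \<in> pclass (map_matrix (twist A) B)"
    then obtain c where "c \<noteq> 0" "X = mat c ** map_matrix (twist A) B" unfolding pclass_eq by blast
    then have "twist A c \<noteq> 0" "X = map_matrix (twist A) (mat (twist A c) ** B)"
      by (simp_all add: *)
    then show "X \<in> map_matrix (twist A) ` pclass B" unfolding pclass_eq by blast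
  qed
qed

text \<open>The automorphism attached to A is an involution, so the inverse in the definition of the
  twisted product is that automorphism itself.\<close>

lemma mult_PGL2_twisted:
  assumes "det A \<noteq> 0" "det B \<noteq> 0"
  shows "pclass A \<otimes>\<^bsub>PGL2_twisted q\<^esub> pclass B = pclass (A ** map_matrix (twist A) B)"
proof -
  have phi: "phi_bar q (pclass A) = (\<lambda>Y. map_matrix (twist A) ` Y)"
  proof -
    have "map_matrix (\<lambda>x. x) = (id :: 'k ^ 2 ^ 2 \<Rightarrow> _)" by (simp add: fun_eq_iff matrix_eq_2)
    then show ?thesis by (simp add: phi_bar_pclass twist_def)
  qed
  have "inv_into (carrier PGL2) (phi_bar q (pclass A)) (pclass B) = pclass (map_matrix (twist A) B)"
  proof (rule inv_into_f_eq)
    show "inj_on (phi_bar q (pclass A)) (carrier PGL2)"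
      unfolding phi by (rule inj_onI) (metis inj_image_eq_iff inj_def map_matrix_twist)
  qed (use assms in \<open>auto simp: phi map_matrix_pclass carrier_PGL2
      intro!: exI[of _ "map_matrix (twist A) B"]\<close>)
  then show ?thesis using assms by (simp add: PGL2_twisted_def mult_PGL2)
qed

lemma carrier_PGL2_twisted: "carrier (PGL2_twisted q) = {pclass A |A :: 'k ^ 2 ^ 2. det A \<noteq> 0}"
  by (simp add: PGL2_twisted_def carrier_PGL2)

lemma one_PGL2_twisted: "\<one>\<^bsub>PGL2_twisted q\<^esub> = pclass (mat 1)"
  by (simp add: PGL2_twisted_def one_PGL2)

lemma group_PGL2_twisted: "group (PGL2_twisted q :: ('k ^ 2 ^ 2) set monoid)"
proof (rule groupI)
  show "X \<otimes>\<^bsub>PGL2_twisted q\<^esub> Y \<in> carrier (PGL2_twisted q)"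
    if XY: "X \<in> carrier (PGL2_twisted q)" "Y \<in> carrier (PGL2_twisted q)" for X Y :: "('k ^ 2 ^ 2) set"
  proof -
    obtain A B where AB: "det A \<noteq> 0" "det B \<noteq> 0" "X = pclass A" "Y = pclass B"
      using XY by (auto simp: carrier_PGL2_twisted)
    then have "det (A ** map_matrix (twist A) B) \<noteq> 0" by (simp add: det_mul)
    with AB show ?thesis by (auto simp: carrier_PGL2_twisted mult_PGL2_twisted)
  qed
  show "\<one>\<^bsub>PGL2_twisted q\<^esub> \<in> carrier (PGL2_twisted q :: ('k ^ 2 ^ 2) set monoid)"
  proof -
    have "det (mat 1 :: 'k ^ 2 ^ 2) \<noteq> 0" by simp
    then show ?thesis unfolding carrier_PGL2_twisted one_PGL2_twisted by blast
  qed
  show "X \<otimes>\<^bsub>PGL2_twisted q\<^esub> Y \<otimes>\<^bsub>PGL2_twisted q\<^esub> Z = X \<otimes>\<^bsub>PGL2_twisted q\<^esub> (Y \<otimes>\<^bsub>PGL2_twisted q\<^esub> Z)"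
    if XYZ: "X \<in> carrier (PGL2_twisted q)" "Y \<in> carrier (PGL2_twisted q)" "Z \<in> carrier (PGL2_twisted q)"
    for X Y Z :: "('k ^ 2 ^ 2) set"
  proof -
    obtain A B C where ABC: "det A \<noteq> 0" "det B \<noteq> 0" "det C \<noteq> 0"
        "X = pclass A" "Y = pclass B" "Z = pclass C"
      using XYZ by (auto simp: carrier_PGL2_twisted)
    \<comment> \<open>The cocycle rule behind associativity: the twist of a twisted product is the
      composite of the twists.\<close>
    have "map_matrix (twist A) (B ** map_matrix (twist B) C) =
        map_matrix (twist A) B ** map_matrix (twist (A ** map_matrix (twist A) B)) C"
      using ABC by (simp add: matrix_eq_2 matrix_mult_2 twist_mult)
    then show ?thesis using ABC by (simp add: mult_PGL2_twisted det_mul matrix_mul_assoc)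
  qed
  show "\<one>\<^bsub>PGL2_twisted q\<^esub> \<otimes>\<^bsub>PGL2_twisted q\<^esub> X = X"
    if X: "X \<in> carrier (PGL2_twisted q)" for X :: "('k ^ 2 ^ 2) set"
  proof -
    have "twist (mat 1) = (\<lambda>x. x)" 
      by (auto simp: twist_def unit_square_def dest: spec[of _ 1])
    then have "map_matrix (twist (mat 1)) A = A" for A :: "'k ^ 2 ^ 2" by (simp add: matrix_eq_2)
    moreover obtain A where "det A \<noteq> 0" "X = pclass A"
      using X by (auto simp: carrier_PGL2_twisted)
    ultimately show ?thesis by (simp add: one_PGL2_twisted mult_PGL2_twisted)
  qed
  show "\<exists>Y\<in>carrier (PGL2_twisted q). Y \<otimes>\<^bsub>PGL2_twisted q\<^esub> X = \<one>\<^bsub>PGL2_twisted q\<^esub>"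
    if X: "X \<in> carrier (PGL2_twisted q)" for X :: "('k ^ 2 ^ 2) set"
  proof -
    obtain A where A: "det A \<noteq> 0" "X = pclass A" using X by (auto simp: carrier_PGL2_twisted)
    then obtain C where C: "det C \<noteq> 0" "C ** A = mat 1" using moebius_inverse by metis
    \<comment> \<open>Here the twist applied is that of the left factor B. It equals the twist of A,
      because det C and det A are inverse to each other and Frobenius preserves square classes;
      hence the product untwists to C A.\<close>
    define B where "B = map_matrix (twist A) C"
    have "det (C ** A) = 1" by (simp add: C)
    then have "det C * det A = 1" by (simp add: det_mul)
    then have "unit_square (det C * det A)" by (simp add: unit_square_def exI[of _ 1])
    then have "unit_square (det B) \<longleftrightarrow> unit_square (det A)"
      using unit_square_mult A(1) C(1) by (simp add: B_def)
    then have "twist B = twist A" by (simp add: twist_def)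
    then have "map_matrix (twist B) (B ** map_matrix (twist B) A) = mat 1"
      using C(2) by (simp add: B_def matrix_eq_2 matrix_mult_2)
    then have "B ** map_matrix (twist B) A = map_matrix (twist B) (mat 1)" by (metis map_matrix_twist)
    also have "\<dots> = mat 1" by (simp add: matrix_eq_2 mat_2)
    finally have "pclass B \<otimes>\<^bsub>PGL2_twisted q\<^esub> X = \<one>\<^bsub>PGL2_twisted q\<^esub>"
      using A C by (simp add: mult_PGL2_twisted one_PGL2_twisted B_def)
    moreover have "det B \<noteq> 0" using C by (simp add: B_def)
    ultimately show ?thesis unfolding carrier_PGL2_twisted by blast
  qed
qed

text \<open>The choice of a representative is harmless, since \<open>twisted_moebius_scale\<close>
  makes the permutation constant on a projective class.\<close>

definition class_to_M :: "('k ^ 2 ^ 2) set \<Rightarrow> 'k option \<Rightarrow> 'k option" where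
  "class_to_M X = twisted_moebius q (SOME A. A \<in> X)"

lemma class_to_M_pclass:
  assumes "det A \<noteq> 0" shows "class_to_M (pclass A) = twisted_moebius q A"
proof -
  have "(SOME B. B \<in> pclass A) \<in> pclass A" using self_in_pclass by (rule someI)
  then show ?thesis
    using assms by (auto simp: class_to_M_def pclass_eq twisted_moebius_scale)
qed

lemma class_to_M_iso: "class_to_M \<in> iso (PGL2_twisted q) (M_group q)"
proof (rule isoI)
  show "class_to_M \<in> hom (PGL2_twisted q) (M_group q)"
  proof (rule homI)
    fix X Y :: "('k ^ 2 ^ 2) set" assume "X \<in> carrier (PGL2_twisted q)" "Y \<in> carrier (PGL2_twisted q)"
    then obtain A B where "det A \<noteq> 0" "det B \<noteq> 0" "X = pclass A" "Y = pclass B"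
      by (auto simp: carrier_PGL2_twisted)
    moreover from this have "twisted_moebius q A \<in> carrier (M_group q)" "twisted_moebius q B \<in> carrier (M_group q)"
      by (auto simp: carrier_M_group)
    ultimately show "class_to_M (X \<otimes>\<^bsub>PGL2_twisted q\<^esub> Y) = class_to_M X \<otimes>\<^bsub>M_group q\<^esub> class_to_M Y"
      by (simp add: mult_PGL2_twisted class_to_M_pclass det_mul M_group_simps(2) twisted_moebius_mult)
  qed (auto simp: carrier_PGL2_twisted carrier_M_group class_to_M_pclass)
  have "inj_on class_to_M (carrier (PGL2_twisted q))"
  proof (rule inj_onI)
    fix X Y :: "('k ^ 2 ^ 2) set" assume XY: "X \<in> carrier (PGL2_twisted q)" "Y \<in> carrier (PGL2_twisted q)" "class_to_M X = class_to_M Y"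
    then obtain A B where AB: "det A \<noteq> 0" "det B \<noteq> 0" "X = pclass A" "Y = pclass B"
      by (auto simp: carrier_PGL2_twisted)
    with XY have eq: "twisted_moebius q A = twisted_moebius q B" by (simp add: class_to_M_pclass)
    \<comment> \<open>Field automorphisms fix \<infinity>, 0 and 1, so the twists drop out at these
      points before they are known to agree.\<close>
    have "moebius A w = moebius B w" if "w \<in> {None, Some 0, Some 1}" for w
      using that fun_cong[OF eq, of w] by (auto simp: twisted_moebius_eq)
    from moebius_eq_three_points[OF AB(1,2) this]
    show "X = Y" unfolding AB by (metis pclass_scale)
  qed
  moreover have "class_to_M ` carrier (PGL2_twisted q) = carrier (M_group q)"
    by (force simp: carrier_PGL2_twisted carrier_M_group class_to_M_pclass)
  ultimately show "bij_betw class_to_M (carrier (PGL2_twisted q)) (carrier (M_group q))"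
    by (simp add: bij_betw_def)
qed

text \<open>Twists fix the three points, so the matrix is scalar; its determinant is then a square,
  and no Frobenius remains.\<close>

lemma M_group_eq_id:
  fixes h :: "'k option \<Rightarrow> 'k option"
  assumes "h \<in> carrier (M_group q)" "h None = None" "h (Some 0) = Some 0" "h (Some 1) = Some 1"
  shows "h = id"
proof -
  obtain A where A: "det A \<noteq> 0" "h = twisted_moebius q A" using assms(1) by (auto simp: carrier_M_group)
  moreover from this have "moebius A None = None" "moebius A (Some 0) = Some 0" "moebius A (Some 1) = Some 1"
    using assms(2-4) by (simp_all add: twisted_moebius_eq)
  ultimately show ?thesis
    using moebius_fixing_three_points[of A] twisted_moebius_mat by metis
qed

end


section \<open>The double coset decomposition and the relations in an arbitrary group\<close>

context group begin

definition cell :: "'a set \<Rightarrow> 'a \<Rightarrow> 'a set" where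
  "cell N T = N \<union> {y \<otimes> T \<otimes> z |y z. y \<in> N \<and> z \<in> N}"

definition double_cell :: "'a set \<Rightarrow> 'a \<Rightarrow> 'a \<Rightarrow> 'a set" where
  "double_cell N T J = cell N T \<union> {b \<otimes> J \<otimes> c |b c. b \<in> cell N T \<and> c \<in> cell N T}"

text \<open>The one case that needs the braid relation is J b J c with b = y T z. There J y T z J =
  (J y J) (J T J) (J z J) has outer factors in N, and J T J = T J T leaves a single J between two
  elements of \<open>cell N T\<close>.\<close>

lemma double_cell_left_mult:
  assumes N: "subgroup N G" and T: "T \<in> carrier G" "T \<otimes> T = \<one>"
    and J: "J \<in> carrier G" "J \<otimes> J = \<one>" "J \<otimes> T \<otimes> J = T \<otimes> J \<otimes> T"
    and JNJ: "\<And>x. x \<in> N \<Longrightarrow> J \<otimes> x \<otimes> J \<in> N"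
    and TNT: "\<And>x. x \<in> N \<Longrightarrow> T \<otimes> x \<otimes> T \<in> cell N T"
    and g: "g \<in> double_cell N T J" and s: "s \<in> N \<or> s = T \<or> s = J"
  shows "s \<otimes> g \<in> double_cell N T J"
proof -
  interpret N: subgroup N G by (rule N)
  note [simp] = T J(1,2)
  have B_closed: "b \<in> carrier G" if "b \<in> cell N T" for b
    using that by (auto simp: cell_def)
  have NB: "x \<otimes> b \<in> cell N T" if x: "x \<in> N" and b: "b \<in> cell N T" for x b
  proof -
    consider "b \<in> N" | y z where "y \<in> N" "z \<in> N" "b = y \<otimes> T \<otimes> z"
      using b by (auto simp: cell_def)
    then show ?thesis
    proof cases
      case 2
      then have "x \<otimes> b = (x \<otimes> y) \<otimes> T \<otimes> z" using x by (simp add: m_assoc)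
      then show ?thesis using 2 x by (auto simp: cell_def)
    qed (use x in \<open>simp add: cell_def\<close>)
  qed
  have BN: "b \<otimes> x \<in> cell N T" if x: "x \<in> N" and b: "b \<in> cell N T" for x b
  proof -
    consider "b \<in> N" | y z where "y \<in> N" "z \<in> N" "b = y \<otimes> T \<otimes> z"
      using b by (auto simp: cell_def)
    then show ?thesis
    proof cases
      case 2
      then have "b \<otimes> x = y \<otimes> T \<otimes> (z \<otimes> x)" using x by (simp add: m_assoc)
      then show ?thesis using 2 x by (auto simp: cell_def)
    qed (use x in \<open>simp add: cell_def\<close>)
  qed
  have TB: "T \<otimes> b \<in> cell N T" if b: "b \<in> cell N T" for b
  proof -
    consider "b \<in> N" | y z where "y \<in> N" "z \<in> N" "b = y \<otimes> T \<otimes> z"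
      using b by (auto simp: cell_def)
    then show ?thesis
    proof cases
      case 1
      then have "T \<otimes> b = \<one> \<otimes> T \<otimes> b" by simp
      then show ?thesis using 1 N.one_closed unfolding cell_def by blast
    next
      case 2
      then have "T \<otimes> b = (T \<otimes> y \<otimes> T) \<otimes> z" by (simp add: m_assoc)
      then show ?thesis using BN[OF 2(2) TNT[OF 2(1)]] by simp
    qed
  qed
  have sB: "s \<otimes> b \<in> cell N T" if "b \<in> cell N T" "s \<noteq> J" for b
    using that s NB TB by auto
  have s_closed: "s \<in> carrier G" using s by auto
  have "T \<in> cell N T" using TB[of \<one>] by (simp add: cell_def)
  have "\<one> \<in> cell N T" by (simp add: cell_def)
  have BJB: "b \<otimes> J \<otimes> c \<in> double_cell N T J" if "b \<in> cell N T" "c \<in> cell N T" for b c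
    using that by (auto simp: double_cell_def)
  consider "g \<in> cell N T" | b c where "b \<in> cell N T" "c \<in> cell N T" "g = b \<otimes> J \<otimes> c"
    using g by (auto simp: double_cell_def)
  then show ?thesis
  proof cases
    case 1
    show ?thesis
    proof (cases "s = J")
      case True
      then show ?thesis using BJB[OF \<open>\<one> \<in> cell N T\<close> 1] B_closed[OF 1] by simp
    next
      case False
      then show ?thesis using sB[OF 1] by (simp add: double_cell_def)
    qed
  next
    case 2
    note closed = B_closed[OF 2(1)] B_closed[OF 2(2)]
    show ?thesis
    proof (cases "s = J")
      case False
      then have "s \<otimes> g = (s \<otimes> b) \<otimes> J \<otimes> c" using 2 closed s_closed by (simp add: m_assoc)
      then show ?thesis using BJB[OF sB[OF 2(1) False] 2(2)] by simp
    next
      case sJ: True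
      consider "b \<in> N" | y z where "y \<in> N" "z \<in> N" "b = y \<otimes> T \<otimes> z"
        using 2(1) by (auto simp: cell_def)
      then show ?thesis
      proof cases
        case 1
        then have "s \<otimes> g = (J \<otimes> b \<otimes> J) \<otimes> c" using 2 closed sJ by (simp add: m_assoc)
        then show ?thesis using NB[OF JNJ[OF 1] 2(2)] by (simp add: double_cell_def)
      next
        case yz: 2
        define y' z' where "y' = J \<otimes> y \<otimes> J" and "z' = J \<otimes> z \<otimes> J"
        have JJ: "J \<otimes> (J \<otimes> x) = x" if "x \<in> carrier G" for x
          using that by (simp flip: m_assoc)
        have JTJ: "J \<otimes> (T \<otimes> (J \<otimes> x)) = T \<otimes> (J \<otimes> (T \<otimes> x))" if "x \<in> carrier G" for x
          using that J(3) by (simp flip: m_assoc)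
        have y'z': "y' \<in> N" "z' \<in> N" using yz JNJ by (auto simp: y'_def z'_def)
        have "y = J \<otimes> y' \<otimes> J" "z = J \<otimes> z' \<otimes> J"
          using yz by (simp_all add: y'_def z'_def m_assoc JJ)
        then have "s \<otimes> g = (y' \<otimes> T) \<otimes> J \<otimes> (T \<otimes> (z' \<otimes> c))"
          using 2(3) yz(3) sJ y'z' closed by (simp add: m_assoc JJ JTJ)
        moreover have "y' \<otimes> T \<in> cell N T" using NB[OF y'z'(1) \<open>T \<in> cell N T\<close>] .
        moreover have "T \<otimes> (z' \<otimes> c) \<in> cell N T" using TB NB y'z' 2 by blast
        ultimately show ?thesis using BJB by simp
      qed
    qed
  qed
qed

lemma conj_int_pow:
  assumes "x \<in> carrier G" "y \<in> carrier G"
  shows "(x \<otimes> y \<otimes> inv x) [^] (i::int) = x \<otimes> y [^] i \<otimes> inv x"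
proof -
  have "(\<lambda>y. x \<otimes> y \<otimes> inv x) \<in> hom G G"
  proof (rule homI)
    have "inv x \<otimes> (x \<otimes> z) = z" if "z \<in> carrier G" for z
      using assms that by (simp flip: m_assoc)
    then show "x \<otimes> (y \<otimes> z) \<otimes> inv x = (x \<otimes> y \<otimes> inv x) \<otimes> (x \<otimes> z \<otimes> inv x)"
      if "y \<in> carrier G" "z \<in> carrier G" for y z
      using assms that by (simp add: m_assoc)
  qed (simp add: assms)
  from hom_int_pow[OF this assms(2) is_group is_group, of i] show ?thesis by simp
qed

lemma int_pow_two: "x \<in> carrier G \<Longrightarrow> x [^] (2::int) = x \<otimes> x"
  by (simp add: int_pow_def2 numeral_2_eq_2)

lemma int_pow_three: "x \<in> carrier G \<Longrightarrow> x [^] (3::int) = x \<otimes> x \<otimes> x"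
  by (simp add: int_pow_def2 numeral_3_eq_3)

end

text \<open>The value of the word for \<open>R(\<zeta>\<^sup>k)\<close>, where \<open>k\<close> is already reduced modulo \<open>q\<^sup>2 - 1\<close>.\<close>

definition R_elem :: "('h, 'b) monoid_scheme \<Rightarrow> 'h \<Rightarrow> 'h \<Rightarrow> int \<Rightarrow> 'h" where
  "R_elem H a J k =
    commutator H J a [^]\<^bsub>H\<^esub> ((k + 1) div 2) \<otimes>\<^bsub>H\<^esub> a [^]\<^bsub>H\<^esub> (k mod 2)"

text \<open>Real ceilings and floors of halves become integer \<open>div\<close> and
  \<open>mod\<close>, on which all later exponent arithmetic is done.\<close>

lemma R_word_eq_R_elem: "R_word q k = R_elem FG sym_a sym_J (k mod ((int q)\<^sup>2 - 1))"
proof -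
  have "\<lceil>real_of_int r / 2\<rceil> = (r + 1) div 2" for r
    by (cases "even r") (auto elim!: evenE oddE simp: add_divide_distrib ceiling_eq_iff)
  moreover have "r - 2 * \<lfloor>real_of_int r / 2\<rfloor> = r mod 2" for r
    using floor_divide_of_int_eq[of r 2, where 'a=real] by (simp add: minus_mult_div_eq_mod)
  ultimately show ?thesis by (simp add: R_word_def R_elem_def Let_def)
qed

text \<open>Stated for three elements of any group, the relations can be a hypothesis on the
  generators of the presented group and a goal for the three permutations.\<close>

definition M_relations_hold :: "nat \<Rightarrow> 'k::field \<Rightarrow> ('h, 'b) monoid_scheme \<Rightarrow> 'h \<Rightarrow> 'h \<Rightarrow> 'h \<Rightarrow> bool" where
  "M_relations_hold q \<zeta> H a T J \<longleftrightarrow>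
    (let D = commutator H J a; n = (int q)\<^sup>2 - 1; R = (\<lambda>k. R_elem H a J (k mod n)) in
      D [^]\<^bsub>H\<^esub> (n div 2) = \<one>\<^bsub>H\<^esub> \<and>
      a [^]\<^bsub>H\<^esub> (2::int) = D [^]\<^bsub>H\<^esub> (- ((int q + 1) div 2)) \<and>
      conjugate H a D = D [^]\<^bsub>H\<^esub> (int q - 1) \<otimes>\<^bsub>H\<^esub> a \<and>
      T [^]\<^bsub>H\<^esub> (2::int) = \<one>\<^bsub>H\<^esub> \<and>
      (\<forall>j k. 1 \<le> j \<and> j < q\<^sup>2 - 1 \<and> is_k q \<zeta> j k \<and> even k \<longrightarrow>
        T \<otimes>\<^bsub>H\<^esub> R (int j) \<otimes>\<^bsub>H\<^esub> T =
          R (int k) \<otimes>\<^bsub>H\<^esub> T \<otimes>\<^bsub>H\<^esub> R (n div 2 - int k + int j)) \<and>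
      (\<forall>j k. 1 \<le> j \<and> j < q\<^sup>2 - 1 \<and> is_k q \<zeta> j k \<and> odd k \<longrightarrow>
        T \<otimes>\<^bsub>H\<^esub> R (int j) \<otimes>\<^bsub>H\<^esub> T =
          R (int k) \<otimes>\<^bsub>H\<^esub> T \<otimes>\<^bsub>H\<^esub> R (n div 2 - int q * int k + int q * int j)) \<and>
      J [^]\<^bsub>H\<^esub> (2::int) = \<one>\<^bsub>H\<^esub> \<and>
      (J \<otimes>\<^bsub>H\<^esub> D) [^]\<^bsub>H\<^esub> (2::int) = \<one>\<^bsub>H\<^esub> \<and>
      (J \<otimes>\<^bsub>H\<^esub> T) [^]\<^bsub>H\<^esub> (3::int) = \<one>\<^bsub>H\<^esub>)"

lemma (in group) commutator_closed [simp]: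
  "x \<in> carrier G \<Longrightarrow> y \<in> carrier G \<Longrightarrow> commutator G x y \<in> carrier G"
  by (simp add: commutator_def)

lemma (in group) R_elem_closed [simp]:
  "a \<in> carrier G \<Longrightarrow> J \<in> carrier G \<Longrightarrow> R_elem G a J k \<in> carrier G"
  by (simp add: R_elem_def)

lemma (in group) conjugate_closed [simp]:
  "x \<in> carrier G \<Longrightarrow> y \<in> carrier G \<Longrightarrow> conjugate G x y \<in> carrier G"
  by (simp add: conjugate_def)

context group_hom begin

lemma hom_commutator:
  "x \<in> carrier G \<Longrightarrow> y \<in> carrier G \<Longrightarrow> h (commutator G x y) = commutator H (h x) (h y)"
  by (simp add: commutator_def)

lemma hom_conjugate:
  "x \<in> carrier G \<Longrightarrow> y \<in> carrier G \<Longrightarrow> h (conjugate G x y) = conjugate H (h x) (h y)"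
  by (simp add: conjugate_def)

lemma hom_R_elem:
  "a \<in> carrier G \<Longrightarrow> J \<in> carrier G \<Longrightarrow> h (R_elem G a J k) = R_elem H (h a) (h J) k"
  by (simp add: R_elem_def hom_int_pow hom_commutator)

end

text \<open>Used in both directions: for the projection onto the presented group it yields the
  relations there; for evaluation in M(q^2) it supplies the hypothesis of
  \<open>von_Dyck\<close>.\<close>

lemma hom_M_relations_iff:
  assumes "group_hom FG H \<phi>"
  shows "(\<forall>(l, r)\<in>M_relations q \<zeta>. \<phi> l = \<phi> r) \<longleftrightarrow>
    M_relations_hold q \<zeta> H (\<phi> sym_a) (\<phi> sym_T) (\<phi> sym_J)"
proof -
  interpret \<phi>: group_hom FG H \<phi> by (rule assms)
  note hom = R_word_eq_R_elem \<phi>.hom_mult \<phi>.hom_int_pow \<phi>.hom_R_elem \<phi>.hom_commutator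
    \<phi>.hom_conjugate \<phi>.hom_one \<phi>.G.int_pow_closed \<phi>.G.m_closed \<phi>.G.R_elem_closed
    \<phi>.G.commutator_closed \<phi>.G.conjugate_closed free_gen_closed
  have family: "(\<forall>(l, r)\<in>{(f j k, g j k) |j k. P j k}. \<phi> l = \<phi> r) \<longleftrightarrow>
      (\<forall>j k. P j k \<longrightarrow> \<phi> (f j k) = \<phi> (g j k))" for f g and P :: "nat \<Rightarrow> nat \<Rightarrow> bool"
    by blast
  have single: "(\<forall>(l, r)\<in>insert (x, y) X. \<phi> l = \<phi> r) \<longleftrightarrow>
      \<phi> x = \<phi> y \<and> (\<forall>(l, r)\<in>X. \<phi> l = \<phi> r)" for x y X
    by simp
  show ?thesis
    unfolding M_relations_def M_relations_hold_def Let_def ball_Un family single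
    by (simp only: hom conj_assoc ball_empty simp_thms)
qed

lemma M_relations_closed: "M_relations q \<zeta> \<subseteq> carrier FG \<times> carrier FG"
proof -
  interpret F: group FG by (rule group_free_group)
  show ?thesis by (auto simp: M_relations_def R_word_eq_R_elem)
qed


section \<open>Consequences of the relations\<close>

context field_q2 begin

lemma is_k_exists:
  assumes "1 \<le> j" "j < q\<^sup>2 - 1"
  obtains k where "is_k q \<zeta> j k"
proof -
  have "\<zeta> ^ j \<noteq> 1" using assms zeta_order[of j] by (auto dest: dvd_imp_le)
  then obtain l :: nat where l: "1 - \<zeta> ^ j = \<zeta> ^ l"
    using nonzero_eq_zeta_power[of "1 - \<zeta> ^ j"] by auto
  define k where "k = l mod (q\<^sup>2 - 1)"
  have pos: "0 < q\<^sup>2 - 1" using n_nat n_pos by linarith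
  have "\<zeta> ^ l = \<zeta> ^ (k + (q\<^sup>2 - 1) * (l div (q\<^sup>2 - 1)))" by (simp add: k_def)
  also have "\<dots> = \<zeta> ^ k" using zeta_order[of "q\<^sup>2 - 1"] by (simp add: power_add power_mult)
  finally have k: "1 - \<zeta> ^ j = \<zeta> ^ k" using l by simp
  \<comment> \<open>Exponent 0 would mean \<zeta>^j = 0; this secures the lower bound in
    \<open>is_k\<close>.\<close>
  have "k \<noteq> 0"
  proof
    assume "k = 0"
    then show False using k zeta_nonzero by simp
  qed
  moreover have "k < q\<^sup>2 - 1" unfolding k_def using pos by simp
  ultimately show ?thesis using that[of k] k by (simp add: is_k_def)
qed

end

locale M_relations_group = field_q2 p m q \<zeta> + group G
  for p m q :: nat and \<zeta> :: "'k::{field, finite}" and G (structure) +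
  fixes a T J
  assumes closed [simp]: "a \<in> carrier G" "T \<in> carrier G" "J \<in> carrier G"
    and relations: "M_relations_hold q \<zeta> G a T J"
begin

definition D where "D = commutator G J a"

text \<open>Exponents are left unreduced so that the product rules are linear in them;
  \<open>R_periodic\<close> recovers that only residues modulo n count.\<close>

definition R :: "int \<Rightarrow> _" where "R k = D [^] ((k + 1) div 2) \<otimes> a [^] (k mod 2)"

lemma D_closed [simp]: "D \<in> carrier G"
  by (simp add: D_def)

lemma R_closed [simp]: "R k \<in> carrier G"
  by (simp add: R_def)

lemma R_elem_eq_R: "R_elem G a J k = R k"
  by (simp add: R_elem_def R_def D_def)

lemma D_order: "D [^] (n div 2) = \<one>"
  and a_square: "a \<otimes> a = D [^] (- ((int q + 1) div 2))"
  and D_conj_a: "inv D \<otimes> a \<otimes> D = D [^] (int q - 1) \<otimes> a"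
  and TT: "T \<otimes> T = \<one>"
  and JJ: "J \<otimes> J = \<one>"
  and JDJD: "(J \<otimes> D) \<otimes> (J \<otimes> D) = \<one>"
  and JTJTJT: "(J \<otimes> T) \<otimes> (J \<otimes> T) \<otimes> (J \<otimes> T) = \<one>"
  using relations
  by (simp_all add: M_relations_hold_def Let_def conjugate_def int_pow_two int_pow_three flip: D_def)

text \<open>Leaving the last exponent existential merges the two parities of k; the shape R T R is
  what places the product in \<open>cell\<close>.\<close>

lemma T_R_T:
  assumes "1 \<le> j" "j < q\<^sup>2 - 1" "is_k q \<zeta> j k"
  obtains l where "T \<otimes> R (int j mod n) \<otimes> T = R (int k mod n) \<otimes> T \<otimes> R (l mod n)"
proof (cases "even k")
  case True
  then show ?thesis
    using relations assms that unfolding M_relations_hold_def Let_def R_elem_eq_R by blast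
next
  case False
  then show ?thesis
    using relations assms that unfolding M_relations_hold_def Let_def R_elem_eq_R by blast
qed

lemma R_even: "even k \<Longrightarrow> R k = D [^] (k div 2)"
  by (simp add: R_def)

lemma R_odd: "odd k \<Longrightarrow> R k = D [^] ((k + 1) div 2) \<otimes> a"
  by (simp add: R_def odd_iff_mod_2_eq_one)

text \<open>Adding a multiple of n keeps the parity, hence the power of a, and shifts the exponent
  of D by a multiple of n/2, where \<open>D_order\<close> applies.\<close>

lemma R_periodic: "R (k mod n) = R k"
proof -
  obtain h where h: "n = 2 * h" using even_n by (rule evenE)
  have "D [^] h = \<one>" using D_order unfolding h by simp
  then have period: "D [^] (i + h * j) = D [^] i" for i j
    using int_pow_pow[of D h j] by (simp add: int_pow_mult)
  have "R (i + n * j) = R i" for i j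
  proof -
    have "(i + 2 * w + 1) div 2 = (i + 1) div 2 + w" "(i + 2 * w) mod 2 = i mod 2" for w :: int
      by presburger+
    moreover have eq: "i + n * j = i + 2 * (h * j)" by (simp add: h)
    ultimately show ?thesis unfolding R_def eq by (simp only: period)
  qed
  from this[of "k mod n" "k div n"] show ?thesis by simp
qed

lemma R_cong: "n dvd k - l \<Longrightarrow> R k = R l"
  using R_periodic by (metis mod_eq_dvd_iff)

lemma R_0: "R 0 = \<one>"
  by (simp add: R_def)

text \<open>The conjugation relation amounts to a D a^-1 = D^q, and conjugation by a is a
  homomorphism. This is the abstract trace of Frobenius acting on \<zeta>^2.\<close>

lemma a_D_pow: "a \<otimes> D [^] i = D [^] (int q * i) \<otimes> a"
proof -
  have "a \<otimes> D = D \<otimes> (inv D \<otimes> a \<otimes> D)" by (simp flip: m_assoc)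
  also have "\<dots> = D [^] (1::int) \<otimes> (D [^] (int q - 1) \<otimes> a)" by (simp add: D_conj_a)
  also have "\<dots> = D [^] int q \<otimes> a" by (simp del: int_pow_1 flip: m_assoc int_pow_mult)
  finally have "a \<otimes> D \<otimes> inv a = D [^] int q" by (simp add: m_assoc)
  then have "D [^] (int q * i) = a \<otimes> D [^] i \<otimes> inv a"
    using conj_int_pow[of a D i] by (simp add: int_pow_pow)
  then show ?thesis by (simp add: m_assoc)
qed

lemma R_mult_even:
  assumes "even k" shows "R k \<otimes> R l = R (k + l)"
proof -
  obtain i where i: "k = 2 * i" using assms by (rule evenE)
  have "(k + l + 1) div 2 = k div 2 + (l + 1) div 2" "(k + l) mod 2 = l mod 2"
    unfolding i by presburger+
  then show ?thesis
    by (simp add: R_even[OF assms]) (simp add: R_def int_pow_mult m_assoc)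
qed

text \<open>Together with \<open>R_mult_even\<close> this is the nearfield product on exponents: an
  odd left factor carries Frobenius, which multiplies the right exponent by q.\<close>

lemma R_mult_odd:
  assumes "odd k" shows "R k \<otimes> R l = R (k + int q * l)"
proof -
  obtain i where i: "k = 2 * i + 1" using assms by (rule oddE)
  obtain t where t: "int q = 2 * t + 1" by (rule half_q)
  have eq: "R k \<otimes> R l = D [^] (i + 1 + int q * ((l + 1) div 2)) \<otimes> (a \<otimes> a [^] (l mod 2))"
  proof -
    have "R k \<otimes> R l = D [^] (i + 1) \<otimes> (a \<otimes> D [^] ((l + 1) div 2)) \<otimes> a [^] (l mod 2)"
      using assms by (simp add: R_odd) (simp add: R_def i m_assoc)
    then show ?thesis by (simp add: a_D_pow int_pow_mult m_assoc)
  qed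
  show ?thesis
  proof (cases "even l")
    case True
    then obtain j where j: "l = 2 * j" by (rule evenE)
    have "odd (k + int q * l)" by (simp add: i j)
    moreover have "(k + int q * l + 1) div 2 = i + 1 + int q * j"
      by (simp add: i j)
    moreover have "(l + 1) div 2 = j" "l mod 2 = 0" by (simp_all add: j)
    ultimately show ?thesis unfolding eq R_odd[OF \<open>odd (k + int q * l)\<close>] by (simp only: int_pow_0 r_one closed)
  next
    case False
    then obtain j where j: "l = 2 * j + 1" by (rule oddE)
    \<comment> \<open>Both exponents are odd, so both were rounded up, with total excess 1/2 + q/2 =
      t + 1 in the power of D. The relation for a^2 removes exactly this excess.\<close>
    have "k + int q * l = 2 * (i + 1 + int q * (j + 1) - (t + 1))"
      by (simp add: i j t algebra_simps)
    then have ev: "even (k + int q * l)" "(k + int q * l) div 2 = i + 1 + int q * (j + 1) - (t + 1)"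
      by simp_all
    have "(l + 1) div 2 = j + 1" "l mod 2 = 1" by (simp_all add: j)
    moreover have "a \<otimes> a = D [^] (- (t + 1))"
    proof -
      have "(int q + 1) div 2 = t + 1" by (simp add: t)
      then show ?thesis unfolding a_square by simp
    qed
    ultimately have "R k \<otimes> R l = D [^] (i + 1 + int q * (j + 1) + - (t + 1))"
      unfolding eq by (simp only: int_pow_mult[symmetric] D_closed int_pow_1 closed)
    then show ?thesis unfolding R_even[OF ev(1)] ev(2) by simp
  qed
qed

lemma subgroup_R: "subgroup (range R) G"
proof (rule subgroupI)
  fix x assume "x \<in> range R"
  then obtain k where x: "x = R k" by blast
  \<comment> \<open>The solution of l + k = 0 or of l + q k = 0; since q is odd, l has the parity of
    k, which decides the product rule.\<close>
  define l where "l = (if even k then - k else - (int q * k))"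
  have "R l \<otimes> x = R 0"
  proof (cases "even k")
    case False
    then have "odd l" using odd_q by (simp add: l_def)
    then show ?thesis using False by (simp add: x R_mult_odd) (simp add: l_def)
  qed (simp add: x l_def R_mult_even)
  then have "inv x = R l" by (intro inv_equality) (simp_all add: x R_0)
  then show "inv x \<in> range R" by blast
next
  fix x y assume "x \<in> range R" "y \<in> range R"
  then obtain k l where "x = R k" "y = R l" by blast
  then show "x \<otimes> y \<in> range R" by (cases "even k") (simp_all add: R_mult_even R_mult_odd)
qed auto

lemma inv_J: "inv J = J" by (simp add: JJ inv_equality)

lemma J_conj_mult:
  assumes "x \<in> carrier G" "y \<in> carrier G"
  shows "J \<otimes> (x \<otimes> y) \<otimes> J = (J \<otimes> x \<otimes> J) \<otimes> (J \<otimes> y \<otimes> J)"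
proof -
  have "J \<otimes> (J \<otimes> z) = z" if "z \<in> carrier G" for z
    using that by (simp add: JJ flip: m_assoc)
  then show ?thesis using assms by (simp add: m_assoc)
qed

text \<open>(J D)^2 = 1 makes J invert D, and D = [J, a] gives J a J = D a. So for k = 2 i + 1 the
  element D^(i+1) a becomes D^(-(i+1)) D a = D^(-i) a.\<close>

lemma J_R_J: "J \<otimes> R k \<otimes> J = R (- k)"
proof -
  have "J \<otimes> D \<otimes> J = inv D"
    using JDJD by (intro inv_equality[symmetric]) (simp_all add: m_assoc)
  then have JDJ: "J \<otimes> D [^] i \<otimes> J = D [^] (- i)" for i :: int
    using conj_int_pow[of J D i] by (simp add: inv_J int_pow_inv int_pow_neg)
  show ?thesis
  proof (cases "even k")
    case True
    then have "- (k div 2) = - k div 2" by presburger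
    with True show ?thesis by (simp add: R_even JDJ)
  next
    case False
    then obtain i where i: "k = 2 * i + 1" by (rule oddE)
    have "D = J \<otimes> a \<otimes> J \<otimes> inv a" by (simp add: D_def commutator_def inv_J)
    then have JaJ: "J \<otimes> a \<otimes> J = D [^] (1::int) \<otimes> a" by (simp add: m_assoc)
    have "R k = D [^] (i + 1) \<otimes> a" using False by (simp add: R_odd i add.commute)
    then have "J \<otimes> R k \<otimes> J = D [^] (- (i + 1)) \<otimes> (D [^] (1::int) \<otimes> a)"
      by (simp only: J_conj_mult int_pow_closed D_closed closed JDJ JaJ)
    also have "\<dots> = D [^] (- i) \<otimes> a" by (simp del: int_pow_1 flip: m_assoc int_pow_mult)
    also have "- i = (- k + 1) div 2" unfolding i by presburger
    also have "D [^] ((- k + 1) div 2) \<otimes> a = R (- k)" using False by (intro R_odd[symmetric]) simp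
    finally show ?thesis .
  qed
qed

text \<open>For the involutions J and T this braid relation is another form of (J T)^3 = 1.\<close>

lemma J_T_J: "J \<otimes> T \<otimes> J = T \<otimes> J \<otimes> T"
proof -
  have "(J \<otimes> T \<otimes> J) \<otimes> (T \<otimes> J \<otimes> T) = \<one>" using JTJTJT by (simp add: m_assoc)
  then have "J \<otimes> T \<otimes> J = inv (T \<otimes> J \<otimes> T)" by (intro inv_equality[symmetric]) simp_all
  also have "\<dots> = T \<otimes> J \<otimes> T"
  proof (rule inv_equality)
    have "T \<otimes> (T \<otimes> z) = z" "J \<otimes> (J \<otimes> z) = z" if "z \<in> carrier G" for z
      using that by (simp_all add: JJ TT flip: m_assoc)
    then show "T \<otimes> J \<otimes> T \<otimes> (T \<otimes> J \<otimes> T) = \<one>" by (simp add: m_assoc TT)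
  qed simp_all
  finally show ?thesis .
qed

text \<open>The defining relations cover the nonzero residues of k modulo n; for residue 0, R k is
  the identity and T T = 1 lies in N.\<close>

lemma T_R_T_mem_cell: "T \<otimes> R k \<otimes> T \<in> cell (range R) T"
proof (cases "n dvd k")
  case True
  then have "R k = \<one>" using R_cong[of k 0] by (simp add: R_0)
  then show ?thesis
    using subgroup.one_closed[OF subgroup_R] by (simp add: TT cell_def)
next
  case False
  define j where "j = nat (k mod n)"
  have j: "int j = k mod n" using n_pos by (simp add: j_def)
  then have "1 \<le> j" using False by (auto simp: Suc_le_eq dvd_eq_mod_eq_0 intro!: gr0I)
  moreover have "j < q\<^sup>2 - 1" using j n_nat pos_mod_bound[OF n_pos(1), of k] by linarith
  ultimately obtain k' l where "T \<otimes> R (int j mod n) \<otimes> T = R (int k' mod n) \<otimes> T \<otimes> R (l mod n)"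
    using is_k_exists T_R_T by metis
  then have "T \<otimes> R k \<otimes> T = R (int k') \<otimes> T \<otimes> R l"
    using j by (simp add: R_periodic)
  then show ?thesis unfolding cell_def by blast
qed

lemma inv_generators:
  "inv a \<in> range R" "a \<in> range R" "inv T = T" "inv J = J"
proof -
  \<comment> \<open>Rounding -1/2 up gives D-exponent 0, and -1 is odd; this matches a being
    \<omega> \<mapsto> \<zeta>^-1 \<omega>^q.\<close>
  have "R (- 1) = a" by (simp add: R_def)
  then show "a \<in> range R" by (metis rangeI)
  then show "inv a \<in> range R" by (rule subgroup.m_inv_closed[OF subgroup_R])
qed (simp_all add: JJ TT inv_equality)

lemma double_cell_generators:
  assumes "g \<in> double_cell (range R) T J" "s \<in> {a, inv a, T, inv T, J, inv J}"
  shows "s \<otimes> g \<in> double_cell (range R) T J"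
proof (rule double_cell_left_mult[OF subgroup_R closed(2) TT closed(3) JJ J_T_J _ _ assms(1)])
  show "s \<in> range R \<or> s = T \<or> s = J" using assms(2) inv_generators by auto
qed (use J_R_J T_R_T_mem_cell in auto)

end


section \<open>The relations in \<open>M(q\<^sup>2)\<close>\<close>

context field_q2 begin

abbreviation MG :: "('k option \<Rightarrow> 'k option) monoid" where "MG \<equiv> M_group q"

text \<open>The permutation represented by \<open>R(\<zeta>\<^sup>k)\<close>.\<close>

definition scal :: "int \<Rightarrow> 'k option \<Rightarrow> 'k option" where
  "scal k = map_option (\<lambda>\<omega>. \<zeta> powi k * (if even k then \<omega> else frob q \<omega>))"

lemma powi_add: "\<zeta> powi (k + l) = \<zeta> powi k * \<zeta> powi l"
  using zeta_nonzero by (simp add: power_int_add)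

text \<open>The law of \<open>R_mult_even\<close> and \<open>R_mult_odd\<close> again: an outer
  Frobenius raises the inner scalar to the power q, and q odd keeps the parities consistent.\<close>

lemma scal_scal:
  "scal k \<circ> scal l = scal (if even k then k + l else k + int q * l)"
proof
  fix w
  show "(scal k \<circ> scal l) w = scal (if even k then k + l else k + int q * l) w"
    using odd_q by (cases w) (simp_all add: scal_def powi_add frob_zeta_powi)
qed

lemma scal_cong:
  assumes "n dvd k - l" shows "scal k = scal l"
proof -
  have "even (k - l)" using assms even_n dvd_trans by blast
  then have "even k \<longleftrightarrow> even l" by presburger
  moreover have "\<zeta> powi k = \<zeta> powi l" using assms by (simp add: zeta_powi_eq_iff)
  ultimately show ?thesis by (simp add: scal_def)
qed

lemma scal_mod: "scal (k mod n) = scal k"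
  by (rule scal_cong) (simp add: mod_eq_dvd_iff[symmetric])

lemma scal_0: "scal 0 = id"
  by (simp add: scal_def fun_eq_iff option.map_ident)

lemma J_scal: "perm_J \<circ> scal k = scal (- k) \<circ> perm_J"
proof
  fix w
  have "inverse (frob q z) = frob q (inverse z :: 'k)" for z
    using frob_hom(4)[of 1 z] by (simp add: inverse_eq_divide)
  then show "(perm_J \<circ> scal k) w = (scal (- k) \<circ> perm_J) w"
    using zeta_nonzero
    by (cases w) (auto simp: scal_def perm_J_def power_int_minus)
qed

lemma J_J: "perm_J \<circ> perm_J = id"
  by (auto simp: perm_J_def fun_eq_iff split: option.splits)

lemma T_T: "perm_T \<circ> perm_T = id"
  by (auto simp: perm_T_def fun_eq_iff option.map_comp o_def option.map_ident)

lemma J_scal_J: "perm_J \<circ> scal k \<circ> perm_J = scal (- k)"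
  unfolding J_scal by (simp add: comp_assoc J_J)

text \<open>J after T is z \<mapsto> 1/(1 - z), of order three, which cycles \<infinity>, 0,
  1.\<close>

lemma JTJTJT: "perm_J \<circ> perm_T \<circ> (perm_J \<circ> perm_T) \<circ> (perm_J \<circ> perm_T) = (id :: 'k option \<Rightarrow> _)"
proof
  fix w :: "'k option"
  show "(perm_J \<circ> perm_T \<circ> (perm_J \<circ> perm_T) \<circ> (perm_J \<circ> perm_T)) w = id w"
  proof (cases w)
    case (Some z)
    have "1 - inverse (1 - z) = - z / (1 - z)" if "z \<noteq> 1"
      using that by (simp add: field_simps)
    then show ?thesis
      using Some by (auto simp: perm_J_def perm_T_def field_simps)
  qed (simp add: perm_J_def perm_T_def)
qed

lemma T_scal_T:
  assumes "is_k q \<zeta> j k"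
  shows "perm_T \<circ> scal (int j) \<circ> perm_T = scal (int k) \<circ> perm_T \<circ>
    scal (if even k then n div 2 - int k + int j else n div 2 - int q * int k + int q * int j)"
proof -
  define l where "l = (if even k then n div 2 - int k + int j else n div 2 - int q * int k + int q * int j)"
  \<comment> \<open>Since n/2 is even, l has the parity of j - k, so the twists belonging to k and l
    compose to the one belonging to j.\<close>
  have "even (n div 2)" using four_dvd_n by presburger
  then have parity: "even l \<longleftrightarrow> (even j \<longleftrightarrow> even k)" using odd_q by (auto simp: l_def)
  have sum: "\<zeta> ^ k = 1 - \<zeta> ^ j" using assms by (simp add: is_k_def)
  \<comment> \<open>The inner scalar as it appears after the twist of k: n/2 supplies the sign, and
    for odd k this Frobenius undoes the factor q built into l.\<close>
  have powi_l: "(if even k then \<zeta> powi l else frob q (\<zeta> powi l)) = - (\<zeta> ^ j / \<zeta> ^ k)"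
  proof (cases "even k")
    case True
    then show ?thesis
      using zeta_nonzero by (simp add: l_def powi_add power_int_diff zeta_powi_half)
  next
    case False
    have "l = n div 2 + int q * (int j - int k)" using False by (simp add: l_def algebra_simps)
    then have "\<zeta> powi l = - frob q (\<zeta> powi (int j - int k))"
      by (simp only: powi_add zeta_powi_half frob_zeta_powi mult_minus1)
    then show ?thesis using False zeta_nonzero by (simp add: power_int_diff)
  qed
  have "(perm_T \<circ> scal (int j) \<circ> perm_T) w = (scal (int k) \<circ> perm_T \<circ> scal l) w" for w
  proof (cases w)
    case (Some z)
    let ?f = "\<lambda>i x. if even i then x else frob q (x :: 'k)"
    have "\<zeta> ^ k * ?f k (1 - \<zeta> powi l * ?f l z) = \<zeta> ^ k * (1 + \<zeta> ^ j / \<zeta> ^ k * ?f j z)"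
      using powi_l parity by (auto simp: split: if_splits)
    also have "\<dots> = \<zeta> ^ k + \<zeta> ^ j * ?f j z" using zeta_nonzero by (simp add: field_simps)
    also have "\<dots> = 1 - \<zeta> ^ j * ?f j (1 - z)"
      unfolding sum by (simp add: algebra_simps)
    finally show ?thesis by (simp add: Some perm_T_def scal_def)
  qed (simp add: perm_T_def scal_def)
  then show ?thesis unfolding l_def by blast
qed

section \<open>Matrices of the generators and the relations between the permutations\<close>

definition matrix2 :: "'k \<Rightarrow> 'k \<Rightarrow> 'k \<Rightarrow> 'k \<Rightarrow> 'k ^ 2 ^ 2" where
  "matrix2 a b c d = (\<chi> i j. if i = 1 then if j = 1 then a else b else if j = 1 then c else d)"

lemma matrix2_nth [simp]:
  "matrix2 a b c d $ 1 $ 1 = a" "matrix2 a b c d $ 1 $ 2 = b"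
  "matrix2 a b c d $ 2 $ 1 = c" "matrix2 a b c d $ 2 $ 2 = d"
  by (simp_all add: matrix2_def)

lemma twisted_moebius_mem: "det A \<noteq> 0 \<Longrightarrow> twisted_moebius q A \<in> carrier MG"
  by (auto simp: carrier_M_group)

text \<open>-1 is \<zeta> to the even exponent n/2. The matrices of T and J have determinant -1, so
  both permutations carry no Frobenius.\<close>

lemma unit_square_minus_1: "unit_square (- 1 :: 'k)"
  using four_dvd_n unit_square_zeta_powi[of "n div 2"] unfolding zeta_powi_half by presburger

lemma scal_mem: "scal k \<in> carrier (M_group q)"
proof -
  have "scal k = twisted_moebius q (matrix2 (\<zeta> powi k) 0 0 1)"
    by (auto simp: scal_def twisted_moebius_eq twist_def det_2 unit_square_zeta_powi
        moebius_def fun_eq_iff split: option.split)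
  then show ?thesis using zeta_nonzero by (simp add: twisted_moebius_mem det_2)
qed

lemma T_mem: "perm_T \<in> carrier MG"
proof -
  have "perm_T = twisted_moebius q (matrix2 (- 1) 1 0 1)"
    by (auto simp: perm_T_def twisted_moebius_eq twist_def det_2 unit_square_minus_1
        moebius_def fun_eq_iff option.map_ident split: option.split)
  moreover have "det (matrix2 (- 1) 1 0 1) \<noteq> 0" by (simp add: det_2)
  ultimately show ?thesis using twisted_moebius_mem by metis
qed

lemma J_mem: "perm_J \<in> carrier MG"
proof -
  have "perm_J = twisted_moebius q (matrix2 0 1 1 0)"
    by (auto simp: perm_J_def twisted_moebius_eq twist_def det_2 unit_square_minus_1
        moebius_def fun_eq_iff option.map_ident inverse_eq_divide split: option.split)
  moreover have "det (matrix2 0 1 1 0) \<noteq> 0" by (simp add: det_2)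
  ultimately show ?thesis using twisted_moebius_mem by metis
qed

lemma a_eq_scal: "perm_a q \<zeta> = scal (- 1)"
  by (simp add: perm_a_def scal_def frob_def power_int_minus)

lemma mult_scal [simp]: "scal k \<otimes>\<^bsub>MG\<^esub> scal l = scal (if even k then k + l else k + int q * l)"
  by (simp add: M_group_simps(2) scal_mem scal_scal)

lemma inv_scal: "inv\<^bsub>MG\<^esub> scal k = scal (if even k then - k else - (int q * k))"
proof -
  interpret M: group MG by (rule group_M_group)
  show ?thesis
    using odd_q by (intro M.inv_equality) (simp_all add: scal_mem M_group_simps(3) scal_0)
qed

lemma scal_pow: "scal 2 [^]\<^bsub>MG\<^esub> (i::int) = scal (2 * i)"
proof -
  interpret M: group MG by (rule group_M_group)
  have nat_pow: "scal 2 [^]\<^bsub>MG\<^esub> k = scal (2 * int k)" for k :: nat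
    by (induction k) (simp_all add: M_group_simps(3) scal_0 algebra_simps)
  show ?thesis
    by (simp add: int_pow_def2 nat_pow inv_scal)
qed

text \<open>The inverse of a = \<open>scal (- 1)\<close> is \<open>scal q\<close>, and conjugation
  by J negates exponents, so the commutator is \<open>scal (1 + q * q)\<close>; modulo n its
  exponent is 2.\<close>

lemma commutator_J_a: "commutator MG perm_J (perm_a q \<zeta>) = scal 2"
proof -
  interpret M: group MG by (rule group_M_group)
  have "inv\<^bsub>MG\<^esub> perm_J = perm_J"
    by (intro M.inv_equality) (simp_all add: J_mem M_group_simps(2,3) J_J)
  then have "commutator MG perm_J (perm_a q \<zeta>) = perm_J \<circ> scal (- 1) \<circ> perm_J \<circ> scal (int q)"
    using M.m_closed[OF J_mem scal_mem[of "-1"]]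
      M.m_closed[OF M.m_closed[OF J_mem scal_mem[of "-1"]] J_mem]
    by (simp add: commutator_def a_eq_scal inv_scal M_group_simps(2) J_mem scal_mem)
  also have "\<dots> = scal (1 + int q * int q)"
    by (simp add: J_scal_J scal_scal)
  also have "\<dots> = scal 2" by (rule scal_cong) (simp add: power2_eq_square)
  finally show ?thesis .
qed

text \<open>This accounts for the rounding up in R: for k = 2 i + 1 the factor a contributes
  exponent -1, so D, which is \<open>scal 2\<close>, must occur i + 1 times.\<close>

lemma R_elem_scal: "R_elem MG (perm_a q \<zeta>) perm_J (k mod n) = scal k"
proof -
  interpret M: group MG by (rule group_M_group)
  have "R_elem MG (perm_a q \<zeta>) perm_J k = scal k" for k
  proof (cases "even k")
    case True
    then show ?thesis
      by (simp add: R_elem_def commutator_J_a scal_pow scal_mem)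
  next
    case False
    then obtain i where "k = 2 * i + 1" by (rule oddE)
    then show ?thesis
      by (simp add: R_elem_def commutator_J_a[unfolded a_eq_scal] scal_pow scal_mem a_eq_scal
          algebra_simps)
  qed
  then show ?thesis by (simp add: scal_mod)
qed

lemma M_relations_hold_M_group: "M_relations_hold q \<zeta> MG (perm_a q \<zeta>) perm_T perm_J"
proof -
  interpret M: group MG by (rule group_M_group)
  note mem = scal_mem T_mem J_mem
  obtain t where t: "int q = 2 * t + 1" by (rule half_q)
  have "scal 2 [^]\<^bsub>MG\<^esub> (n div 2) = \<one>\<^bsub>MG\<^esub>"
    using even_n scal_cong[of n 0] by (simp add: scal_pow scal_0 M_group_simps(3))
  moreover have "perm_a q \<zeta> [^]\<^bsub>MG\<^esub> (2::int) = scal 2 [^]\<^bsub>MG\<^esub> (- ((int q + 1) div 2))"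
    by (simp add: M.int_pow_two mem a_eq_scal scal_pow) (simp add: t)
  moreover have "conjugate MG (perm_a q \<zeta>) (scal 2) =
      scal 2 [^]\<^bsub>MG\<^esub> (int q - 1) \<otimes>\<^bsub>MG\<^esub> perm_a q \<zeta>"
    by (simp add: conjugate_def a_eq_scal scal_pow inv_scal mult.commute)
  moreover have "perm_T [^]\<^bsub>MG\<^esub> (2::int) = \<one>\<^bsub>MG\<^esub>" "perm_J [^]\<^bsub>MG\<^esub> (2::int) = \<one>\<^bsub>MG\<^esub>"
    by (simp_all add: M.int_pow_two mem M_group_simps(2,3) T_T J_J)
  moreover have "perm_T \<otimes>\<^bsub>MG\<^esub> scal (int j) \<otimes>\<^bsub>MG\<^esub> perm_T = scal (int k) \<otimes>\<^bsub>MG\<^esub> perm_T \<otimes>\<^bsub>MG\<^esub>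
      scal (if even k then n div 2 - int k + int j else n div 2 - int q * int k + int q * int j)"
    if "is_k q \<zeta> j k" for j k
    using T_scal_T[OF that] M.m_closed[OF T_mem scal_mem] M.m_closed[OF scal_mem T_mem]
    by (simp only: M_group_simps(2) mem)
  moreover have "(perm_J \<otimes>\<^bsub>MG\<^esub> scal 2) [^]\<^bsub>MG\<^esub> (2::int) = \<one>\<^bsub>MG\<^esub>"
  proof -
    have "perm_J \<circ> scal 2 \<circ> (perm_J \<circ> scal 2) = (perm_J \<circ> scal 2 \<circ> perm_J) \<circ> scal 2"
      by (simp add: comp_assoc)
    also have "\<dots> = id" by (simp add: J_scal_J scal_scal scal_0)
    finally show ?thesis
      using M.m_closed[OF J_mem scal_mem[of 2]]
      by (simp add: M.int_pow_two mem M_group_simps(2,3))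
  qed
  moreover have "(perm_J \<otimes>\<^bsub>MG\<^esub> perm_T) [^]\<^bsub>MG\<^esub> (3::int) = \<one>\<^bsub>MG\<^esub>"
  proof -
    have JT: "perm_J \<otimes>\<^bsub>MG\<^esub> perm_T = perm_J \<circ> perm_T" by (simp add: M_group_simps(2) mem)
    have mem_JT: "perm_J \<circ> perm_T \<in> carrier MG" using M.m_closed[OF J_mem T_mem] by (simp add: JT)
    moreover have "perm_J \<circ> perm_T \<circ> (perm_J \<circ> perm_T) \<in> carrier MG"
      using M.m_closed[OF mem_JT mem_JT] mem_JT by (simp add: M_group_simps(2))
    ultimately show ?thesis
      unfolding JT by (simp add: M.int_pow_three M_group_simps(2,3) JTJTJT)
  qed
  ultimately show ?thesis
    unfolding M_relations_hold_def Let_def commutator_J_a R_elem_scal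
    by (auto simp del: mult_scal)
qed

section \<open>Triple transitivity and generation of M(q^2)\<close>

lemma scal_to_1:
  assumes "z \<noteq> 0" obtains k where "scal k (Some z) = Some 1"
proof -
  obtain k where k: "z = \<zeta> powi k" using nonzero_eq_zeta_powi[OF assms] by blast
  show ?thesis
  proof (cases "even k")
    case True
    then have "scal (- k) (Some z) = Some 1"
      using zeta_nonzero by (simp add: scal_def k power_int_minus)
    then show ?thesis by (rule that)
  next
    case False
    \<comment> \<open>With k odd the map applies Frobenius to z, so the exponent to be cancelled is
      q k.\<close>
    then have "scal (- (int q * k)) (Some z) = Some 1"
      using zeta_nonzero odd_q by (simp add: scal_def k power_int_minus frob_zeta_powi)
    then show ?thesis by (rule that)
  qed
qed

text \<open>Elements of S correct h on the left at \<infinity>, then 0, then 1, each fixing the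
  points already settled. The result is the identity, so h is the inverse of an element of
  S.\<close>

lemma generates_M_group:
  assumes S: "subgroup S MG" "range scal \<subseteq> S" "perm_T \<in> S" "perm_J \<in> S"
  shows "S = carrier MG"
proof
  interpret M: group MG by (rule group_M_group)
  interpret S: subgroup S MG by (rule S(1))
  show "S \<subseteq> carrier MG" by (rule S.subset)
  have comp: "s \<circ> h \<in> carrier MG" if "s \<in> S" "h \<in> carrier MG" for s h
    using M.m_closed[of s h] that by (simp add: M_group_simps(2))
  have comp_S: "s \<circ> s' \<in> S" if "s \<in> S" "s' \<in> S" for s s'
    using S.m_closed[of s s'] that by (simp add: M_group_simps(2))
  have scal_None: "scal k None = None" "scal k (Some 0) = Some 0" for k
    by (simp_all add: scal_def)
  have to_0: "\<exists>s\<in>S. s None = None \<and> s (Some z) = Some 0" for z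
  proof (cases "z = 0")
    case True
    then show ?thesis using S(2) scal_None by (auto intro!: bexI[of _ "scal 0"])
  next
    case False
    then obtain k where "scal k (Some z) = Some 1" by (rule scal_to_1)
    then have "(perm_T \<circ> scal k) (Some z) = Some 0" "(perm_T \<circ> scal k) None = None"
      by (simp_all add: perm_T_def scal_None)
    moreover have "perm_T \<circ> scal k \<in> S" using comp_S S by blast
    ultimately show ?thesis by blast
  qed
  have None: "\<exists>s\<in>S. s w = None" for w
  proof (cases w)
    case (Some z)
    then obtain s where "s \<in> S" "s (Some z) = Some 0" using to_0 by blast
    then have "perm_J \<circ> s \<in> S" "(perm_J \<circ> s) w = None"
      using comp_S S Some by (auto simp: perm_J_def)
    then show ?thesis by blast
  qed (use S scal_None in auto)
  have bij: "bij h" if "h \<in> carrier MG" for h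
    using that by (simp add: M_group_simps(1))
  show "carrier MG \<subseteq> S"
  proof
    fix h assume h: "h \<in> carrier MG"
    obtain s1 where s1: "s1 \<in> S" "(s1 \<circ> h) None = None" using None[of "h None"] by auto
    have "(s1 \<circ> h) (Some 0) \<noteq> None"
      using bij[OF comp[OF s1(1) h]] s1(2) by (metis bij_pointE option.distinct(1))
    then obtain z where "(s1 \<circ> h) (Some 0) = Some z" by blast
    then obtain s2 where s2: "s2 \<in> S" "(s2 \<circ> (s1 \<circ> h)) None = None" "(s2 \<circ> (s1 \<circ> h)) (Some 0) = Some 0"
      using to_0[of z] s1(2) by auto
    define g where "g = s2 \<circ> (s1 \<circ> h)"
    have g: "g \<in> carrier MG" using comp s1 s2 h by (simp add: g_def)
    \<comment> \<open>Injectivity keeps the image of 1 away from \<infinity> and 0, so some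
      \<open>scal\<close> moves it to 1.\<close>
    have "g (Some 1) \<noteq> None" "g (Some 1) \<noteq> Some 0"
      using bij[OF g] s2(2,3) unfolding g_def[symmetric]
      by (metis bij_pointE option.distinct(1), metis bij_pointE option.inject zero_neq_one)
    then obtain y where y: "g (Some 1) = Some y" "y \<noteq> 0" by auto
    then obtain k where k: "scal k (Some y) = Some 1" using scal_to_1 by blast
    have "scal k \<in> S" using S by blast
    have "scal k \<circ> g = id"
    proof (rule M_group_eq_id)
      show "scal k \<circ> g \<in> carrier MG" using comp S g by blast
    qed (use s2 y k scal_None in \<open>simp_all flip: g_def\<close>)
    define s where "s = scal k \<circ> (s2 \<circ> s1)"
    have s: "s \<in> S" using comp_S s1 s2 \<open>scal k \<in> S\<close> by (simp add: s_def)
    have "s \<circ> h = id" using \<open>scal k \<circ> g = id\<close> by (simp add: s_def g_def comp_assoc)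
    then have "s \<otimes>\<^bsub>MG\<^esub> h = \<one>\<^bsub>MG\<^esub>" using s h by (simp add: M_group_simps(2,3))
    then have "inv\<^bsub>MG\<^esub> s = h" using s h by (metis M.inv_equality M.inv_inv S.mem_carrier)
    then show "h \<in> S" using s by auto
  qed
qed

end

section \<open>Triviality of the kernel\<close>

context M_relations_group begin

lemma hom_to_M_group_inj:
  assumes hom: "\<Psi> \<in> hom G (M_group q)"
    and gens: "\<Psi> a = perm_a q \<zeta>" "\<Psi> T = perm_T" "\<Psi> J = perm_J"
    and generated: "carrier G \<subseteq> double_cell (range R) T J"
  shows "inj_on \<Psi> (carrier G)"
proof -
  interpret \<Psi>: group_hom G MG \<Psi>
    by (simp add: group_hom_def group_hom_axioms_def is_group group_M_group hom)
  have mult: "\<Psi> (x \<otimes> y) w = \<Psi> x (\<Psi> y w)" if "x \<in> carrier G" "y \<in> carrier G" for x y w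
    using that by (simp add: M_group_simps(2))
  note \<Psi>.hom_mult [simp del]
  have \<Psi>_R: "\<Psi> (R k) = scal k" for k
    using \<Psi>.hom_R_elem[of a J "k mod n"] by (simp add: R_elem_eq_R R_periodic gens R_elem_scal)
  have cell_closed: "b \<in> carrier G" if "b \<in> cell (range R) T" for b
    using that by (auto simp: cell_def)
  have cell_None: "\<Psi> b None = None" if "b \<in> cell (range R) T" for b
    using that by (auto simp: cell_def mult \<Psi>_R gens scal_def perm_T_def)
  have inj: "inj (\<Psi> g)" if "g \<in> carrier G" for g
    using \<Psi>.hom_closed[OF that] by (simp add: M_group_simps(1) bij_is_inj)
  have "g = \<one>" if g: "g \<in> carrier G" "\<Psi> g = \<one>\<^bsub>MG\<^esub>" for g
  proof -
    have id: "\<Psi> g = id" using g(2) by (simp add: M_group_simps(3))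
    have "g \<in> cell (range R) T"
    proof (rule ccontr)
      assume "g \<notin> cell (range R) T"
      then obtain b c where bc: "b \<in> cell (range R) T" "c \<in> cell (range R) T" "g = b \<otimes> J \<otimes> c"
        using generated g(1) by (auto simp: double_cell_def)
      \<comment> \<open>c fixes \<infinity> and J sends it to 0; as g acts trivially, b would send
        both 0 and \<infinity> to \<infinity>.\<close>
      then have "\<Psi> g None = \<Psi> b (Some 0)"
        using cell_closed cell_None by (simp add: mult gens perm_J_def)
      then have "\<Psi> b (Some 0) = \<Psi> b None" using cell_None[OF bc(1)] by (simp add: id)
      then show False using inj[OF cell_closed[OF bc(1)]] by (simp add: inj_eq)
    qed
    moreover have "g \<noteq> R k \<otimes> T \<otimes> R l" for k l
    proof
      assume "g = R k \<otimes> T \<otimes> R l"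
      \<comment> \<open>R l fixes 0 and T sends it to 1, so the image of 0 is \<zeta>^k, which is
        not 0.\<close>
      then have "\<Psi> g (Some 0) = scal k (Some 1)"
        by (simp add: mult \<Psi>_R gens) (simp add: scal_def perm_T_def)
      then show False using zeta_nonzero by (simp add: id scal_def split: if_splits)
    qed
    ultimately obtain k where k: "g = R k" by (auto simp: cell_def)
    have "scal k (Some 1) = Some 1" using id by (simp add: k \<Psi>_R)
    then have "\<zeta> powi k = 1" by (simp add: scal_def split: if_splits)
    then show ?thesis using R_cong[of k 0] by (simp add: k zeta_powi_eq_1 R_0)
  qed
  then have "kernel G MG \<Psi> = {\<one>}" by (auto simp: kernel_def)
  then show ?thesis by (rule \<Psi>.trivial_ker_imp_inj)
qed

end

section \<open>The isomorphism from the presented group\<close>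

context field_q2 begin

lemma presentation_M_relations: "presentation (M_relations q \<zeta>)"
  by standard (rule M_relations_closed)

lemma presented_group_iso_M_group:
  obtains \<Psi> where "\<Psi> \<in> iso (presented_group (M_relations q \<zeta>)) (M_group q)"
    "\<Psi> (presented_gen (M_relations q \<zeta>) Gen_a) = perm_a q \<zeta>"
    "\<Psi> (presented_gen (M_relations q \<zeta>) Gen_T) = perm_T"
    "\<Psi> (presented_gen (M_relations q \<zeta>) Gen_J) = perm_J"
proof -
  interpret P: presentation "M_relations q \<zeta>" by (rule presentation_M_relations)
  interpret M: group MG by (rule group_M_group)
  let ?P = "presented_group (M_relations q \<zeta>)"
  let ?g = "presented_gen (M_relations q \<zeta>)"
  define \<gamma> where "\<gamma> = (\<lambda>x. case x of Gen_a \<Rightarrow> perm_a q \<zeta> | Gen_T \<Rightarrow> perm_T | Gen_J \<Rightarrow> perm_J)"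
  have \<gamma>_closed: "\<gamma> x \<in> carrier MG" for x
    by (simp add: \<gamma>_def a_eq_scal scal_mem T_mem J_mem split: gen.split)
  have "group_hom FG MG (free_lift MG \<gamma>)"
    by (simp add: group_hom_def group_hom_axioms_def group_free_group group_M_group
        M.free_lift_hom \<gamma>_closed)
  from hom_M_relations_iff[OF this, of q \<zeta>]
  have "\<forall>(l, r)\<in>M_relations q \<zeta>. free_lift MG \<gamma> l = free_lift MG \<gamma> r"
    using M_relations_hold_M_group by (simp add: M.free_lift_free_gen \<gamma>_closed) (simp add: \<gamma>_def)
  then obtain \<Psi> where \<Psi>: "\<Psi> \<in> hom ?P MG" "\<And>x. \<Psi> (?g x) = \<gamma> x"
    using P.von_Dyck[OF group_M_group, of \<gamma>] \<gamma>_closed by blast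
  have "group_hom FG ?P P.proj"
    by (simp add: group_hom_def group_hom_axioms_def group_free_group P.group_presented_group P.proj_hom)
  then have relations: "M_relations_hold q \<zeta> ?P (?g Gen_a) (?g Gen_T) (?g Gen_J)"
    using hom_M_relations_iff P.proj_relation by (fastforce simp flip: P.proj_free_gen)
  have gen_closed: "?g x \<in> carrier ?P" for x
    using P.proj_hom by (auto simp: hom_def simp flip: P.proj_free_gen)
  interpret G: M_relations_group p m q \<zeta> ?P "?g Gen_a" "?g Gen_T" "?g Gen_J"
    by (intro M_relations_group.intro field_q2_axioms P.group_presented_group)
      (unfold_locales, simp_all add: gen_closed relations)
  have "g \<in> G.double_cell (range G.R) (?g Gen_T) (?g Gen_J)" if "g \<in> carrier ?P" for g
    using that
  proof (induction rule: P.presented_group_induct)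
    case one
    have "\<one>\<^bsub>?P\<^esub> \<in> range G.R" using G.R_0 by (metis rangeI)
    then show ?case by (simp add: G.double_cell_def G.cell_def)
  next
    case (gen x g)
    then show ?case using G.double_cell_generators by (cases x) auto
  next
    case (inv x g)
    then show ?case using G.double_cell_generators by (cases x) auto
  qed
  then have "inj_on \<Psi> (carrier ?P)"
    using \<Psi> by (intro G.hom_to_M_group_inj) (auto simp: \<gamma>_def)
  moreover have "\<Psi> ` carrier ?P = carrier MG"
  proof (rule generates_M_group)
    interpret \<Psi>: group_hom ?P MG \<Psi>
      by (simp add: group_hom_def group_hom_axioms_def P.group_presented_group group_M_group \<Psi>)
    show "subgroup (\<Psi> ` carrier ?P) MG" by (rule \<Psi>.img_is_subgroup)
    show "range scal \<subseteq> \<Psi> ` carrier ?P"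
    proof
      fix s assume "s \<in> range scal"
      then obtain k where "s = scal k" by blast
      then have "s = \<Psi> (R_elem ?P (?g Gen_a) (?g Gen_J) (k mod n))"
        using \<Psi>.hom_R_elem[of "?g Gen_a" "?g Gen_J"] gen_closed
        by (simp add: \<Psi> R_elem_scal) (simp add: \<gamma>_def R_elem_scal)
      then show "s \<in> \<Psi> ` carrier ?P" using gen_closed by simp
    qed
    show "perm_T \<in> \<Psi> ` carrier ?P" "perm_J \<in> \<Psi> ` carrier ?P"
      using \<Psi>(2)[of Gen_T] \<Psi>(2)[of Gen_J] gen_closed by (auto simp: \<gamma>_def image_iff) metis+
  qed
  ultimately have "\<Psi> \<in> iso ?P MG" using \<Psi>(1) by (auto simp: iso_def bij_betw_def)
  then show ?thesis using that \<Psi>(2) by (simp add: \<gamma>_def)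
qed

end

theorem theorem6p17:
  fixes p m q :: nat and \<zeta> :: "'k::{field, finite}"
  assumes "prime p" and "odd p" and "m \<ge> 1" and "q = p ^ m"
    and "CARD('k) = q\<^sup>2"
    and "primitive_element \<zeta>"
  shows "group (PGL2_twisted q :: ('k ^ 2 ^ 2) set monoid)
    \<and> group (M_group q :: ('k option \<Rightarrow> 'k option) monoid)
    \<and> (\<exists>f h.
         f \<in> iso (PGL2_twisted q :: ('k ^ 2 ^ 2) set monoid) (M_group q)
       \<and> (\<forall>A. det A \<noteq> 0 \<longrightarrow> f (scalars2 #>\<^bsub>GL2\<^esub> A) = twisted_moebius q A)
       \<and> h \<in> iso (presented_group (M_relations q \<zeta>)) (PGL2_twisted q)
       \<and> f (h (presented_gen (M_relations q \<zeta>) Gen_a)) = perm_a q \<zeta>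
       \<and> f (h (presented_gen (M_relations q \<zeta>) Gen_T)) = perm_T
       \<and> f (h (presented_gen (M_relations q \<zeta>) Gen_J)) = perm_J)"
proof -
  interpret field_q2 p m q \<zeta> by standard (use assms in auto)
  obtain \<Psi> where \<Psi>: "\<Psi> \<in> iso (presented_group (M_relations q \<zeta>)) (M_group q)"
    "\<Psi> (presented_gen (M_relations q \<zeta>) Gen_a) = perm_a q \<zeta>"
    "\<Psi> (presented_gen (M_relations q \<zeta>) Gen_T) = perm_T"
    "\<Psi> (presented_gen (M_relations q \<zeta>) Gen_J) = perm_J"
    by (rule presented_group_iso_M_group)
  \<comment> \<open>\<Psi> followed by the inverse of \<open>class_to_M\<close>, so that applying
    \<open>class_to_M\<close> to the images of the generators returns the prescribed
    permutations.\<close>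
  define h where "h = inv_into (carrier (PGL2_twisted q)) class_to_M \<circ> \<Psi>"
  have "h \<in> iso (presented_group (M_relations q \<zeta>)) (PGL2_twisted q)"
    unfolding h_def
    by (rule iso_set_trans[OF \<Psi>(1) group.iso_set_sym[OF group_PGL2_twisted class_to_M_iso]])
  moreover have "class_to_M (inv_into (carrier (PGL2_twisted q)) class_to_M g) = g"
    if "g \<in> carrier MG" for g
    using that class_to_M_iso by (intro f_inv_into_f) (auto simp: iso_def bij_betw_def)
  then have "class_to_M (h (presented_gen (M_relations q \<zeta>) Gen_a)) = perm_a q \<zeta>"
    "class_to_M (h (presented_gen (M_relations q \<zeta>) Gen_T)) = perm_T"
    "class_to_M (h (presented_gen (M_relations q \<zeta>) Gen_J)) = perm_J"
    by (simp_all add: h_def \<Psi> a_eq_scal scal_mem T_mem J_mem)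
  moreover have "\<forall>A. det A \<noteq> 0 \<longrightarrow> class_to_M (scalars2 #>\<^bsub>GL2\<^esub> A) = twisted_moebius q A"
    using class_to_M_pclass by (simp add: pclass_def)
  ultimately show ?thesis
    using group_PGL2_twisted group_M_group class_to_M_iso by blast
qed

end
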